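(* There exists a group $G$ such that, for every integer $k \ge 1$, there is a non-free stably free $\mathbb{Z}G$-module of rank $k$.
   Context: A finitely generated (left) $\mathbb{Z}G$-module $S$ is stably free if $S \oplus \mathbb{Z}G^n \cong \mathbb{Z}G^m$ for some $n,m \ge 0$; its rank is $m-n$ (well defined for integral group rings). *)

theory Defs
  imports "HOL-Algebra.Algebra" "HOL-Library.Poly_Mapping"
begin

(* Elements are the finitely supported functions from G to the integers;
   the product is the bilinear extension of the multiplication of G. *)
definition integral_group_ring :: "('g, 'b) monoid_scheme \<Rightarrow> ('g \<Rightarrow>\<^sub>0 int) ring" where
  "integral_group_ring G =
     \<lparr>carrier = {a. Poly_Mapping.keys a \<subseteq> carrier G},
      monoid.mult = (\<lambda>a b. frag_extend (\<lambda>g. frag_extend (\<lambda>h. frag_of (g \<otimes>\<^bsub>G\<^esub> h)) b) a),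
      monoid.one = frag_of \<one>\<^bsub>G\<^esub>,
      ring.zero = 0,
      ring.add = (+)\<rparr>"

(* The library locale module requires a commutative ring of scalars; these are its axioms over an
   arbitrary ring. The fields mult and one of the record M play no role. *)
locale left_module = R?: ring R + M?: abelian_group M
  for R :: "('a, 'm) ring_scheme" (structure) and M :: "('a, 'b, 'n) module_scheme" (structure) +
  assumes smult_closed:
      "\<lbrakk>a \<in> carrier R; x \<in> carrier M\<rbrakk> \<Longrightarrow> a \<odot>\<^bsub>M\<^esub> x \<in> carrier M"
    and smult_l_distr:
      "\<lbrakk>a \<in> carrier R; b \<in> carrier R; x \<in> carrier M\<rbrakk> \<Longrightarrow>
        (a \<oplus>\<^bsub>R\<^esub> b) \<odot>\<^bsub>M\<^esub> x = a \<odot>\<^bsub>M\<^esub> x \<oplus>\<^bsub>M\<^esub> b \<odot>\<^bsub>M\<^esub> x"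
    and smult_r_distr:
      "\<lbrakk>a \<in> carrier R; x \<in> carrier M; y \<in> carrier M\<rbrakk> \<Longrightarrow>
        a \<odot>\<^bsub>M\<^esub> (x \<oplus>\<^bsub>M\<^esub> y) = a \<odot>\<^bsub>M\<^esub> x \<oplus>\<^bsub>M\<^esub> a \<odot>\<^bsub>M\<^esub> y"
    and smult_assoc:
      "\<lbrakk>a \<in> carrier R; b \<in> carrier R; x \<in> carrier M\<rbrakk> \<Longrightarrow>
        (a \<otimes>\<^bsub>R\<^esub> b) \<odot>\<^bsub>M\<^esub> x = a \<odot>\<^bsub>M\<^esub> (b \<odot>\<^bsub>M\<^esub> x)"
    and smult_one:
      "x \<in> carrier M \<Longrightarrow> \<one>\<^bsub>R\<^esub> \<odot>\<^bsub>M\<^esub> x = x"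

definition module_iso ::
  "('a, 'm) ring_scheme \<Rightarrow> ('a, 'b, 'n) module_scheme \<Rightarrow> ('a, 'c, 'p) module_scheme \<Rightarrow> ('b \<Rightarrow> 'c) set"
where
  "module_iso R M N =
     {f. bij_betw f (carrier M) (carrier N) \<and>
         (\<forall>x\<in>carrier M. \<forall>y\<in>carrier M. f (x \<oplus>\<^bsub>M\<^esub> y) = f x \<oplus>\<^bsub>N\<^esub> f y) \<and>
         (\<forall>a\<in>carrier R. \<forall>x\<in>carrier M. f (a \<odot>\<^bsub>M\<^esub> x) = a \<odot>\<^bsub>N\<^esub> f x)}"

definition module_isomorphic ::
  "('a, 'm) ring_scheme \<Rightarrow> ('a, 'b, 'n) module_scheme \<Rightarrow> ('a, 'c, 'p) module_scheme \<Rightarrow> bool"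
where
  "module_isomorphic R M N \<longleftrightarrow> module_iso R M N \<noteq> {}"

definition module_sum ::
  "('a, 'b, 'n) module_scheme \<Rightarrow> ('a, 'c, 'p) module_scheme \<Rightarrow> ('a, 'b \<times> 'c) module"
where
  "module_sum M N =
     \<lparr>carrier = carrier M \<times> carrier N,
      monoid.mult = undefined,
      monoid.one = undefined,
      ring.zero = (\<zero>\<^bsub>M\<^esub>, \<zero>\<^bsub>N\<^esub>),
      ring.add = (\<lambda>(x, y) (x', y'). (x \<oplus>\<^bsub>M\<^esub> x', y \<oplus>\<^bsub>N\<^esub> y')),
      module.smult = (\<lambda>a (x, y). (a \<odot>\<^bsub>M\<^esub> x, a \<odot>\<^bsub>N\<^esub> y))\<rparr>"

definition ring_power :: "('a, 'm) ring_scheme \<Rightarrow> nat \<Rightarrow> ('a, nat \<Rightarrow> 'a) module" where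
  "ring_power R n =
     \<lparr>carrier = {..<n} \<rightarrow>\<^sub>E carrier R,
      monoid.mult = undefined,
      monoid.one = undefined,
      ring.zero = (\<lambda>i\<in>{..<n}. \<zero>\<^bsub>R\<^esub>),
      ring.add = (\<lambda>x y. \<lambda>i\<in>{..<n}. x i \<oplus>\<^bsub>R\<^esub> y i),
      module.smult = (\<lambda>a x. \<lambda>i\<in>{..<n}. a \<otimes>\<^bsub>R\<^esub> x i)\<rparr>"

definition finitely_generated_module ::
  "('a, 'm) ring_scheme \<Rightarrow> ('a, 'b, 'n) module_scheme \<Rightarrow> bool"
where
  "finitely_generated_module R M \<longleftrightarrow>
     (\<exists>A. finite A \<and> A \<subseteq> carrier M \<and>
        (\<forall>x\<in>carrier M. \<exists>c\<in>A \<rightarrow> carrier R. x = (\<Oplus>\<^bsub>M\<^esub>a\<in>A. c a \<odot>\<^bsub>M\<^esub> a)))"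

(* Coefficient families are required to vanish off B, so that they are determined by their
   restriction to B. *)
definition module_basis ::
  "('a, 'm) ring_scheme \<Rightarrow> ('a, 'b, 'n) module_scheme \<Rightarrow> 'b set \<Rightarrow> bool"
where
  "module_basis R M B \<longleftrightarrow> B \<subseteq> carrier M \<and>
     (\<forall>x\<in>carrier M. \<exists>!c. c \<in> UNIV \<rightarrow> carrier R \<and> finite {b. c b \<noteq> \<zero>\<^bsub>R\<^esub>} \<and> {b. c b \<noteq> \<zero>\<^bsub>R\<^esub>} \<subseteq> B \<and>
        x = (\<Oplus>\<^bsub>M\<^esub>b\<in>{b. c b \<noteq> \<zero>\<^bsub>R\<^esub>}. c b \<odot>\<^bsub>M\<^esub> b))"

definition free_module :: "('a, 'm) ring_scheme \<Rightarrow> ('a, 'b, 'n) module_scheme \<Rightarrow> bool" where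
  "free_module R M \<longleftrightarrow> (\<exists>B. module_basis R M B)"

(* The rank r is determined by M as soon as R has invariant basis number; integral group rings
   do, because the augmentation maps them onto the integers. *)
definition stably_free_of_rank ::
  "('a, 'm) ring_scheme \<Rightarrow> ('a, 'b, 'n) module_scheme \<Rightarrow> int \<Rightarrow> bool"
where
  "stably_free_of_rank R M r \<longleftrightarrow>
     left_module R M \<and> finitely_generated_module R M \<and>
     (\<exists>n m. module_isomorphic R (module_sum M (ring_power R n)) (ring_power R m) \<and>
            r = int m - int n)"

end

theory Submission
  imports Defs "HOL-Library.Countable" "HOL-Library.Multiset"
begin

text \<open>
  In the group ring \<open>T\<^sub>0\<close> of the Klein bottle group \<open>\<langle>x, y | y x y\<^sup>-\<^sup>1 = x\<^sup>-\<^sup>1\<rangle>\<close> put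
  \<open>\<rho> = x\<^sup>3 - x - 1\<close> and \<open>\<eta> = 1 + y\<close>. Since \<open>\<rho>\<close> and its conjugate \<open>\<rho>' = y \<rho> y\<^sup>-\<^sup>1\<close> are comaximal, the row
  \<open>(\<rho>, \<eta>)\<close> has a right inverse \<open>(a, b)\<close>, whose kernel \<open>P\<close> is stably free of rank \<open>1\<close>. Leading
  exponents of \<open>y\<close> show that no homomorphism from \<open>P\<close> to \<open>T\<^sub>0\<close> takes a nonzero integer as a value.

  Let \<open>G\<close> be the free product of countably many copies of this group, and let \<open>S\<close> be the direct sum of
  the modules induced from \<open>P\<close> over the first \<open>k\<close> factors. It is stably free of rank \<open>k\<close>. If it
  were free, a coordinate function would be a surjection from \<open>S\<close> to \<open>\<int>G\<close>, that is, a family of solutions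
  \<open>(v\<^sub>i, w\<^sub>i)\<close> of \<open>\<rho>\<^sub>i v\<^sub>i + \<eta>\<^sub>i w\<^sub>i = 0\<close> generating the unit left ideal. A weak algorithm as in Bergman's theory of
  coproducts excludes this: in a relation \<open>\<Sum> A\<^sub>i v\<^sub>i + B\<^sub>i w\<^sub>i = n \<noteq> 0\<close> the longest words cancel, the letter of
  type \<open>i\<close> in the middle of such a word shows that the leading part of one solution is a combination of
  leading parts of shorter ones, and subtracting that combination yields a smaller family
  with the same property.
\<close>

section \<open>Group rings over type class groups and free products\<close>

lemma lookup_sum_keys:
  assumes "finite S" "Poly_Mapping.keys p \<subseteq> S"
  shows "p = (\<Sum>x\<in>S. Poly_Mapping.single x (Poly_Mapping.lookup p x))"
  using assms
  by (intro poly_mapping_eqI)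
     (auto simp: lookup_sum lookup_single when_def sum.delta in_keys_iff)

text \<open>Polynomial mappings multiply by convolution over an additive monoid, so the type class
  groups are written additively, although they are not commutative. Over a group the convolution
  becomes a single sum, as \<open>x + y = z\<close> determines \<open>y\<close>. Any finite
  \<open>S\<close> containing the support may serve, so that several products can share one index
  set.\<close>

lemma lookup_mult_group:
  fixes p q :: "'g::group_add \<Rightarrow>\<^sub>0 'b::ring_1"
  assumes "finite S" "Poly_Mapping.keys p \<subseteq> S"
  shows "Poly_Mapping.lookup (p * q) z
           = (\<Sum>x\<in>S. Poly_Mapping.lookup p x * Poly_Mapping.lookup q (- x + z))"
proof -
  have *: "z = x + y \<longleftrightarrow> y = - x + z" for x y :: 'g
    by (metis add.assoc add.left_neutral left_minus right_minus)
  have "Poly_Mapping.lookup (p * q) z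
      = (\<Sum>x. Poly_Mapping.lookup p x * (\<Sum>y. Poly_Mapping.lookup q y when z = x + y))"
    by (simp add: lookup_mult)
  also have "\<dots> = (\<Sum>x. Poly_Mapping.lookup p x * Poly_Mapping.lookup q (- x + z))"
    by (simp add: *)
  also have "\<dots> = (\<Sum>x\<in>S. Poly_Mapping.lookup p x * Poly_Mapping.lookup q (- x + z))"
    using assms by (intro Sum_any.expand_superset) (auto simp: in_keys_iff subset_iff dest: mult_not_zero)
  finally show ?thesis .
qed

definition restr :: "('a \<Rightarrow> bool) \<Rightarrow> ('a \<Rightarrow>\<^sub>0 'b::zero) \<Rightarrow> 'a \<Rightarrow>\<^sub>0 'b" where
  "restr P p = Abs_poly_mapping (\<lambda>x. if P x then Poly_Mapping.lookup p x else 0)"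

lemma lookup_restr [simp]:
  "Poly_Mapping.lookup (restr P p) x = (if P x then Poly_Mapping.lookup p x else 0)"
proof -
  have "finite {x. (if P x then Poly_Mapping.lookup p x else 0) \<noteq> 0}"
    by (rule finite_subset[OF _ finite_lookup[of p]]) auto
  then show ?thesis unfolding restr_def by simp
qed

text \<open>The map of group rings induced by a map of groups. It serves for the embeddings of the
  factors, for the augmentation and for the passage to codes in the natural numbers.\<close>

definition push_forward :: "('g \<Rightarrow> 'h) \<Rightarrow> ('g \<Rightarrow>\<^sub>0 'b::comm_monoid_add) \<Rightarrow> 'h \<Rightarrow>\<^sub>0 'b" where
  "push_forward f p = (\<Sum>x\<in>Poly_Mapping.keys p. Poly_Mapping.single (f x) (Poly_Mapping.lookup p x))"

lemma push_forward_superset: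
  assumes "finite S" "Poly_Mapping.keys p \<subseteq> S"
  shows "push_forward f p = (\<Sum>x\<in>S. Poly_Mapping.single (f x) (Poly_Mapping.lookup p x))"
  unfolding push_forward_def using assms
  by (intro sum.mono_neutral_left) (auto simp: in_keys_iff)

lemma push_forward_add: "push_forward f (p + q) = push_forward f p + push_forward f q"
proof -
  let ?S = "Poly_Mapping.keys p \<union> Poly_Mapping.keys q"
  have "Poly_Mapping.keys (p + q) \<subseteq> ?S" by (rule Poly_Mapping.keys_add)
  then show ?thesis
    by (simp add: push_forward_superset[of ?S] lookup_add single_add sum.distrib)
qed

lemma push_forward_single [simp]:
  "push_forward f (Poly_Mapping.single x k) = Poly_Mapping.single (f x) k"
  by (simp add: push_forward_def)

lemma push_forward_0 [simp]: "push_forward f 0 = 0"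
  by (simp add: push_forward_def)

lemma push_forward_sum: "push_forward f (\<Sum>x\<in>S. g x) = (\<Sum>x\<in>S. push_forward f (g x))"
  by (induction S rule: infinite_finite_induct) (simp_all add: push_forward_add)

lemma mult_eq_sum_single:
  fixes p q :: "'g::monoid_add \<Rightarrow>\<^sub>0 'b::semiring_0"
  shows "p * q = (\<Sum>x\<in>Poly_Mapping.keys p. \<Sum>y\<in>Poly_Mapping.keys q.
           Poly_Mapping.single (x + y) (Poly_Mapping.lookup p x * Poly_Mapping.lookup q y))"
  using arg_cong2[OF lookup_sum_keys[OF finite_keys order_refl, of p]
      lookup_sum_keys[OF finite_keys order_refl, of q], of "(*)"]
  by (simp add: sum_product mult_single)

lemma push_forward_mult:
  fixes f :: "'g::monoid_add \<Rightarrow> 'h::monoid_add" and p q :: "'g \<Rightarrow>\<^sub>0 'b::semiring_0"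
  assumes "\<And>x y. f (x + y) = f x + f y"
  shows "push_forward f (p * q) = push_forward f p * push_forward f q"
proof -
  let ?P = "Poly_Mapping.keys p" and ?Q = "Poly_Mapping.keys q"
  have "push_forward f (p * q) = (\<Sum>x\<in>?P. \<Sum>y\<in>?Q. Poly_Mapping.single (f x + f y)
                  (Poly_Mapping.lookup p x * Poly_Mapping.lookup q y))"
    by (simp add: mult_eq_sum_single push_forward_sum assms)
  also have "\<dots> = push_forward f p * push_forward f q"
    by (simp add: push_forward_def sum_product mult_single)
  finally show ?thesis .
qed

lemma push_forward_1:
  fixes f :: "'g::monoid_add \<Rightarrow> 'h::monoid_add"
  assumes "f 0 = 0"
  shows "push_forward f 1 = (1 :: 'h \<Rightarrow>\<^sub>0 'b::semiring_1)"
  using push_forward_single[of f 0 "1 :: 'b"] assms by (simp only: single_one)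

section \<open>Reduced words and their multiplication\<close>

text \<open>In a word over the free product, the letter \<open>(i, g)\<close> stands for the element \<open>g\<close> of the \<open>i\<close>-th factor.\<close>

definition reduced :: "(nat \<times> 'a::zero) list \<Rightarrow> bool" where
  "reduced xs \<longleftrightarrow> 0 \<notin> snd ` set xs \<and> distinct_adj (map fst xs)"

lemma reduced_Nil [simp]: "reduced []"
  by (simp add: reduced_def)

lemma reduced_Cons:
  "reduced ((i, g) # xs) \<longleftrightarrow> g \<noteq> 0 \<and> reduced xs \<and> (xs \<noteq> [] \<longrightarrow> fst (hd xs) \<noteq> i)"
  by (cases xs) (auto simp: reduced_def)

lemma reduced_append:
  "reduced (xs @ ys) \<longleftrightarrow> reduced xs \<and> reduced ys \<and>
     (xs \<noteq> [] \<longrightarrow> ys \<noteq> [] \<longrightarrow> fst (last xs) \<noteq> fst (hd ys))"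
  by (auto simp: reduced_def distinct_adj_append_iff last_map hd_map)

text \<open>Left multiplication of a reduced word by one letter. The product of words is built from
  these operators, in the manner of van der Waerden, so that the group axioms follow from an action
  of each factor on reduced words.\<close>

fun push :: "nat \<Rightarrow> 'a::group_add \<Rightarrow> (nat \<times> 'a) list \<Rightarrow> (nat \<times> 'a) list" where
  "push i g [] = (if g = 0 then [] else [(i, g)])"
| "push i g ((j, h) # xs) =
     (if g = 0 then (j, h) # xs
      else if i \<noteq> j then (i, g) # (j, h) # xs
      else if g + h = 0 then xs else (i, g + h) # xs)"

lemma push_0 [simp]: "push i 0 xs = xs"
  by (cases "(i, 0::'a, xs)" rule: push.cases) auto

lemma push_Cons: "reduced ((i, g) # xs) \<Longrightarrow> push i g xs = (i, g) # xs"
  by (cases "(i, g, xs)" rule: push.cases) (auto simp: reduced_Cons)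

lemma reduced_push: "reduced xs \<Longrightarrow> reduced (push i g xs)"
  by (cases "(i, g, xs)" rule: push.cases) (auto simp: reduced_Cons)

text \<open>Only a head of type \<open>i\<close> needs care: \<open>push\<close> alters that letter
  alone, and the tail behind it does not start with type \<open>i\<close>, so a letter pushed onto
  the tail stays in front of it.\<close>

lemma push_push:
  assumes "reduced xs"
  shows "push i g (push i h xs) = push i (g + h) xs"
proof (cases "h = 0 \<or> g = 0")
  case False
  show ?thesis
  proof (cases "xs = [] \<or> fst (hd xs) \<noteq> i")
    case True
    then show ?thesis using False by (cases xs) auto
  next
    case same: False
    then obtain k ys where xs: "xs = (i, k) # ys" by (cases xs) auto
    have red: "k \<noteq> 0" "push i r ys = (i, r) # ys" if "r \<noteq> 0" for r
      using that assms by (auto simp: xs reduced_Cons intro!: push_Cons)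
    show ?thesis
    proof (cases "h + k = 0")
      case True
      then have k: "k = - h" by (simp add: minus_unique)
      have "g + h = 0 \<Longrightarrow> g = - h" by (simp add: eq_neg_iff_add_eq_0)
      then show ?thesis using False red by (auto simp: xs k add.assoc)
    next
      case hk: False
      have "g + h = 0 \<Longrightarrow> g + (h + k) = k" by (simp flip: add.assoc)
      then show ?thesis using False hk red by (auto simp: xs add.assoc)
    qed
  qed
qed auto

definition wmult :: "(nat \<times> 'a::group_add) list \<Rightarrow> (nat \<times> 'a) list \<Rightarrow> (nat \<times> 'a) list" where
  "wmult xs ys = foldr (\<lambda>(i, g). push i g) xs ys"

lemma wmult_simps [simp]: "wmult [] ys = ys" "wmult ((i, g) # xs) ys = push i g (wmult xs ys)"
  by (simp_all add: wmult_def)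

lemma reduced_wmult: "reduced ys \<Longrightarrow> reduced (wmult xs ys)"
  by (induction xs) (auto simp: reduced_push)

lemma wmult_append: "wmult (xs @ ys) zs = wmult xs (wmult ys zs)"
  by (simp add: wmult_def)

lemma wmult_reduced_append: "reduced (xs @ ys) \<Longrightarrow> wmult xs ys = xs @ ys"
proof (induction xs)
  case (Cons x xs)
  obtain i g where x: "x = (i, g)" by fastforce
  from Cons show ?case by (auto simp: x reduced_Cons intro: push_Cons)
qed simp

lemma wmult_Nil2: "reduced xs \<Longrightarrow> wmult xs [] = xs"
  using wmult_reduced_append[of xs "[]"] by simp

text \<open>If the letter merges with the head of \<open>xs\<close>, this is the action law
  \<open>push_push\<close>; otherwise it holds by definition. Associativity follows from it by
  induction on the first word.\<close>

lemma wmult_push: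
  assumes "reduced xs" "reduced ys"
  shows "wmult (push i g xs) ys = push i g (wmult xs ys)"
proof (cases xs)
  case (Cons x zs)
  obtain j h where x: "x = (j, h)" by fastforce
  have "reduced (wmult zs ys)" using assms by (simp add: reduced_wmult)
  then show ?thesis by (auto simp: Cons x push_push)
qed auto

lemma wmult_assoc:
  assumes "reduced xs" "reduced ys" "reduced zs"
  shows "wmult (wmult xs ys) zs = wmult xs (wmult ys zs)"
  using assms(1)
proof (induction xs)
  case (Cons x xs)
  obtain i g where x: "x = (i, g)" by fastforce
  from Cons have "reduced xs" by (simp add: x reduced_Cons)
  with Cons show ?case using assms by (simp add: x wmult_push reduced_wmult)
qed simp

definition winv :: "(nat \<times> 'a::group_add) list \<Rightarrow> (nat \<times> 'a) list" where
  "winv xs = rev (map (map_prod id uminus) xs)"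

lemma reduced_winv: "reduced xs \<Longrightarrow> reduced (winv xs)"
proof -
  have *: "map fst (winv xs) = rev (map fst xs)" "snd ` set (winv xs) = uminus ` snd ` set xs"
    by (auto simp: winv_def rev_map image_image)
  assume "reduced xs"
  then show ?thesis unfolding reduced_def * by (simp add: image_iff Bex_def)
qed

lemma wmult_winv: "reduced xs \<Longrightarrow> wmult (winv xs) xs = []"
proof (induction xs)
  case (Cons x xs)
  obtain i g where x: "x = (i, g)" by fastforce
  from Cons.prems have r: "reduced xs" "push i g xs = (i, g) # xs"
    by (simp_all add: x reduced_Cons push_Cons)
  have "wmult (winv (x # xs)) (x # xs) = wmult (winv xs) (push i (- g) (push i g xs))"
    by (simp add: x r winv_def wmult_append)
  also have "\<dots> = []" using Cons.IH r(1) by (simp add: push_push del: push.simps)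
  finally show ?case .
qed (simp add: winv_def)

section \<open>The free product of countably many copies of a group\<close>

typedef (overloaded) 'a::group_add free_product = "{xs :: (nat \<times> 'a) list. reduced xs}"
  morphisms letters Abs_free_product
  by (rule exI[of _ "[]"]) simp

lemma reduced_letters [simp]: "reduced (letters w)"
  using letters by blast

instantiation free_product :: (group_add) group_add
begin

definition zero_free_product :: "'a free_product" where "0 = Abs_free_product []"
definition plus_free_product :: "'a free_product \<Rightarrow> 'a free_product \<Rightarrow> 'a free_product" where
  "u + w = Abs_free_product (wmult (letters u) (letters w))"
definition uminus_free_product :: "'a free_product \<Rightarrow> 'a free_product" where
  "- w = Abs_free_product (winv (letters w))"
definition minus_free_product :: "'a free_product \<Rightarrow> 'a free_product \<Rightarrow> 'a free_product" where
  "u - w = u + - w" for u w :: "'a free_product"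

lemma letters_zero [simp]: "letters (0 :: 'a free_product) = []"
  by (simp add: zero_free_product_def Abs_free_product_inverse)

lemma letters_plus: "letters (u + w) = wmult (letters u) (letters w)"
  by (simp add: plus_free_product_def Abs_free_product_inverse reduced_wmult)

lemma letters_uminus: "letters (- w) = winv (letters w)"
  by (simp add: uminus_free_product_def Abs_free_product_inverse reduced_winv)

instance
  by standard
     (simp_all add: letters_inject[symmetric] letters_plus letters_uminus wmult_assoc wmult_Nil2
       wmult_winv minus_free_product_def)

end

text \<open>Countability permits the group to be copied onto a set of natural numbers, the type of
  group elements in the theorem.\<close>

instance free_product :: ("{group_add, countable}") countable
proof
  show "\<exists>f :: 'a free_product \<Rightarrow> nat. inj f"
    by (rule exI[of _ "to_nat \<circ> letters"]) (simp add: inj_on_def letters_inject)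
qed

definition letter :: "nat \<Rightarrow> 'a::group_add \<Rightarrow> 'a free_product" where
  "letter i g = Abs_free_product (push i g [])"

lemma letters_letter: "letters (letter i g) = push i g []"
  unfolding letter_def by (rule Abs_free_product_inverse) (simp add: reduced_push del: push.simps)

lemma letter_add: "letter i (g + h) = letter i g + letter i h"
  by (simp add: letters_inject[symmetric] letters_plus letters_letter push_push[symmetric] wmult_push
       reduced_push del: push.simps)

lemma letter_0 [simp]: "letter i 0 = 0"
  by (simp add: letters_inject[symmetric] letters_letter)

lemma letter_uminus: "letter i (- g) = - letter i g"
proof -
  have "letter i g + letter i (- g) = 0" by (simp flip: letter_add)
  then show ?thesis by (rule minus_unique[symmetric])
qed

lemma letters_letter_plus: "letters (letter i g + w) = push i g (letters w)"
  by (simp add: letters_letter letters_plus wmult_push del: push.simps)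

section \<open>Coordinates over the group ring of a factor\<close>

lemma lookup_map_key: "inj f \<Longrightarrow> Poly_Mapping.lookup (Poly_Mapping.map_key f p) x = Poly_Mapping.lookup p (f x)"
  by (simp add: map_key.rep_eq)

section \<open>Word length, first and last letters\<close>

definition wlen :: "'a::group_add free_product \<Rightarrow> nat" where
  "wlen w = length (letters w)"

definition starts :: "nat \<Rightarrow> 'a::group_add free_product \<Rightarrow> bool" where
  "starts i w \<longleftrightarrow> letters w \<noteq> [] \<and> fst (hd (letters w)) = i"

definition ends :: "nat \<Rightarrow> 'a::group_add free_product \<Rightarrow> bool" where
  "ends i w \<longleftrightarrow> letters w \<noteq> [] \<and> fst (last (letters w)) = i"

lemma starts_uminus: "starts i (- w) \<longleftrightarrow> ends i w"
  by (auto simp: starts_def ends_def letters_uminus winv_def hd_rev last_map)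

lemma letters_letter_plus_reduced:
  "\<not> starts i w \<Longrightarrow> g \<noteq> 0 \<Longrightarrow> letters (letter i g + w) = (i, g) # letters w"
  unfolding letters_letter_plus by (rule push_Cons) (auto simp: reduced_Cons starts_def)

text \<open>No two letters meet that could merge: the concatenation is already reduced and hence is
  the product.\<close>

lemma letters_plus_letter_plus:
  assumes "\<not> ends i u" "\<not> starts i w" "g \<noteq> 0"
  shows "letters (u + letter i g + w) = letters u @ (i, g) # letters w"
proof -
  have "letters (u + (letter i g + w)) = wmult (letters u) ((i, g) # letters w)"
    using assms by (simp add: letters_plus[of u] letters_letter_plus_reduced)
  also have "\<dots> = letters u @ (i, g) # letters w"
  proof (rule wmult_reduced_append)
    have "reduced ((i, g) # letters w)"
      using assms by (simp flip: letters_letter_plus_reduced)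
    then show "reduced (letters u @ (i, g) # letters w)"
      using assms by (auto simp: reduced_append ends_def)
  qed
  finally show ?thesis by (simp add: add.assoc)
qed

lemma letters_plus_letter:
  "\<not> ends i u \<Longrightarrow> g \<noteq> 0 \<Longrightarrow> letters (u + letter i g) = letters u @ [(i, g)]"
  using letters_plus_letter_plus[of i u 0 g] by (simp add: starts_def)

lemma length_push: "length (push i g xs) \<le> Suc (length xs)"
  by (cases "(i, g, xs)" rule: push.cases) auto

lemma length_wmult: "length (wmult xs ys) \<le> length xs + length ys"
proof (induction xs)
  case (Cons x xs)
  obtain i g where "x = (i, g)" by fastforce
  with Cons show ?case using length_push[of i g "wmult xs ys"] by simp
qed simp

lemma wlen_plus: "wlen (u + w) \<le> wlen u + wlen w"
  by (simp add: wlen_def letters_plus length_wmult)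

section \<open>Splitting off a letter of a given type at either end of a word\<close>

definition front :: "nat \<Rightarrow> 'a::group_add free_product \<Rightarrow> 'a" where
  "front i z = (if starts i z then snd (hd (letters z)) else 0)"

definition rest :: "nat \<Rightarrow> 'a::group_add free_product \<Rightarrow> 'a free_product" where
  "rest i z = - letter i (front i z) + z"

lemma front_rest: "letter i (front i z) + rest i z = z"
  by (simp add: rest_def flip: add.assoc)

text \<open>Neighbouring letters of a reduced word have different types, so no letter of type
  \<open>i\<close> comes up behind the one removed. Thus words not starting with type
  \<open>i\<close> represent the cosets of the \<open>i\<close>-th factor.\<close>

lemma not_starts_rest: "\<not> starts i (rest i z)"
proof (cases "starts i z")
  case True
  then obtain g ys where z: "letters z = (i, g) # ys"
    by (cases "letters z") (auto simp: starts_def)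
  have g: "g \<noteq> 0" and ys: "reduced ys" "ys \<noteq> [] \<Longrightarrow> fst (hd ys) \<noteq> i"
    using reduced_letters[of z] by (simp_all add: z reduced_Cons)
  have "letters (rest i z) = push i (- g) ((i, g) # ys)"
    using True by (simp add: rest_def front_def z letters_letter_plus flip: letter_uminus del: push.simps)
  then have "letters (rest i z) = ys" using g by simp
  then show ?thesis using ys by (auto simp: starts_def)
next
  case False
  then show ?thesis by (simp add: rest_def front_def)
qed

lemma front_letter_plus: "\<not> starts i w \<Longrightarrow> front i (letter i g + w) = g"
  by (cases "g = 0") (auto simp: front_def starts_def letters_letter_plus_reduced)

lemma rest_letter_plus: "\<not> starts i w \<Longrightarrow> rest i (letter i g + w) = w"
  by (simp add: rest_def front_letter_plus add.assoc[symmetric])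

text \<open>The decomposition at the right end is the one at the left end, carried over by
  inversion.\<close>

definition rear :: "nat \<Rightarrow> 'a::group_add free_product \<Rightarrow> 'a" where
  "rear i z = - front i (- z)"

definition init :: "nat \<Rightarrow> 'a::group_add free_product \<Rightarrow> 'a free_product" where
  "init i z = - rest i (- z)"

lemma init_rear: "init i z + letter i (rear i z) = z"
  using arg_cong[OF front_rest[of i "- z"], of uminus]
  by (simp add: init_def rear_def letter_uminus minus_add)

lemma not_ends_init: "\<not> ends i (init i z)"
  using not_starts_rest[of i "- z"] by (simp add: init_def flip: starts_uminus)

lemma init_plus_letter:
  assumes "\<not> ends i u"
  shows "init i (u + letter i g) = u" "rear i (u + letter i g) = g"
proof -
  have "- (u + letter i g) = letter i (- g) + - u"
    by (simp add: minus_add letter_uminus)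
  moreover have u: "\<not> starts i (- u)" using assms by (simp add: starts_uminus)
  ultimately show "init i (u + letter i g) = u" "rear i (u + letter i g) = g"
    unfolding init_def rear_def
    by (simp_all only: front_letter_plus[OF u] rest_letter_plus[OF u] minus_minus)
qed

lemma inj_letter: "inj (letter i)"
  by (rule inj_on_inverseI[of _ "front i"]) (use front_letter_plus[of i 0] in \<open>simp add: starts_def\<close>)

text \<open>The coordinates of an element of the group ring of the free product, seen as a free right
  (respectively left) module over the group ring of the \<open>i\<close>-th factor. The representatives are the
  words \<open>u\<close> that do not end (respectively the words \<open>w\<close> that do not start) with a letter of type
  \<open>i\<close>.\<close>

definition right_coord ::
  "nat \<Rightarrow> 'a::group_add free_product \<Rightarrow> ('a free_product \<Rightarrow>\<^sub>0 int) \<Rightarrow> 'a \<Rightarrow>\<^sub>0 int" where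
  "right_coord i u p = Poly_Mapping.map_key (\<lambda>g. u + letter i g) p"

definition left_coord ::
  "nat \<Rightarrow> 'a::group_add free_product \<Rightarrow> ('a free_product \<Rightarrow>\<^sub>0 int) \<Rightarrow> 'a \<Rightarrow>\<^sub>0 int" where
  "left_coord i w p = Poly_Mapping.map_key (\<lambda>g. letter i g + w) p"

lemma lookup_right_coord [simp]:
  "Poly_Mapping.lookup (right_coord i u p) g = Poly_Mapping.lookup p (u + letter i g)"
  unfolding right_coord_def
  by (rule lookup_map_key) (simp add: inj_on_def inj_eq[OF inj_letter])

lemma lookup_left_coord [simp]:
  "Poly_Mapping.lookup (left_coord i w p) g = Poly_Mapping.lookup p (letter i g + w)"
  unfolding left_coord_def
  by (rule lookup_map_key) (simp add: inj_on_def inj_eq[OF inj_letter])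

abbreviation emb :: "nat \<Rightarrow> ('a::group_add \<Rightarrow>\<^sub>0 int) \<Rightarrow> 'a free_product \<Rightarrow>\<^sub>0 int" where
  "emb i \<equiv> push_forward (letter i)"

lemma lookup_single_mult_group:
  fixes q :: "'g::group_add \<Rightarrow>\<^sub>0 'b::ring_1"
  shows "Poly_Mapping.lookup (Poly_Mapping.single x k * q) z = k * Poly_Mapping.lookup q (- x + z)"
  by (subst lookup_mult_group[of "{x}"]) auto

text \<open>Elements of the \<open>i\<close>-th factor multiply the front of a word and leave its
  rest alone. So the coordinates of a solution over the free product are solutions over the
  factor.\<close>

lemma left_coord_emb_mult: "left_coord i w (emb i p * q) = p * left_coord i w q"
proof (rule poly_mapping_eqI)
  fix g
  let ?K = "Poly_Mapping.keys p"
  have "Poly_Mapping.lookup (left_coord i w (emb i p * q)) g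
      = (\<Sum>h\<in>?K. Poly_Mapping.lookup p h * Poly_Mapping.lookup q (- letter i h + (letter i g + w)))"
    by (simp add: push_forward_def sum_distrib_right lookup_sum lookup_single_mult_group)
  also have "\<dots> = (\<Sum>h\<in>?K. Poly_Mapping.lookup p h * Poly_Mapping.lookup (left_coord i w q) (- h + g))"
    by (simp add: letter_add letter_uminus add.assoc)
  also have "\<dots> = Poly_Mapping.lookup (p * left_coord i w q) g"
    by (subst lookup_mult_group[of ?K]) auto
  finally show "Poly_Mapping.lookup (left_coord i w (emb i p * q)) g
      = Poly_Mapping.lookup (p * left_coord i w q) g" .
qed

lemma left_coord_add: "left_coord i w (p + q) = left_coord i w p + left_coord i w q"
  by (rule poly_mapping_eqI) (simp add: lookup_add)

lemma left_coord_0 [simp]: "left_coord i w 0 = 0"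
  by (rule poly_mapping_eqI) simp

text \<open>Expand \<open>p\<close> by right coordinates at the words \<open>u\<close> and
  \<open>q\<close> by left coordinates. For each \<open>u\<close>, the word \<open>- u + z\<close>
  determines the only coordinate of \<open>q\<close> and the only factor element that can contribute
  to the coefficient at \<open>z\<close>.\<close>

lemma lookup_mult_coords:
  assumes "finite U" "\<And>u. u \<in> U \<Longrightarrow> \<not> ends i u" "init i ` Poly_Mapping.keys p \<subseteq> U"
  shows "Poly_Mapping.lookup (p * q) z
           = (\<Sum>u\<in>U. Poly_Mapping.lookup (right_coord i u p * left_coord i (rest i (- u + z)) q)
                       (front i (- u + z)))"
proof -
  let ?G = "rear i ` Poly_Mapping.keys p"
  let ?f = "\<lambda>(u, g). u + letter i g"
  have inj: "inj_on ?f (U \<times> ?G)"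
    by (rule inj_on_inverseI[of _ "\<lambda>x. (init i x, rear i x)"])
       (auto simp: init_plus_letter assms)
  have keys: "Poly_Mapping.keys p \<subseteq> ?f ` (U \<times> ?G)"
  proof
    fix x assume "x \<in> Poly_Mapping.keys p"
    then have "(init i x, rear i x) \<in> U \<times> ?G" using assms by auto
    moreover have "?f (init i x, rear i x) = x" by (simp add: init_rear)
    ultimately show "x \<in> ?f ` (U \<times> ?G)" by (metis imageI)
  qed
  have "Poly_Mapping.lookup (p * q) z
      = (\<Sum>x\<in>?f ` (U \<times> ?G). Poly_Mapping.lookup p x * Poly_Mapping.lookup q (- x + z))"
    using assms keys by (intro lookup_mult_group) auto
  also have "\<dots> = (\<Sum>(u, g)\<in>U \<times> ?G. Poly_Mapping.lookup p (u + letter i g)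
                      * Poly_Mapping.lookup q (- (u + letter i g) + z))"
    by (subst sum.reindex[OF inj]) (simp add: case_prod_beta o_def)
  also have "\<dots> = (\<Sum>u\<in>U. \<Sum>g\<in>?G. Poly_Mapping.lookup p (u + letter i g)
                      * Poly_Mapping.lookup q (- (u + letter i g) + z))"
    by (simp add: sum.cartesian_product)
  also have "\<dots> = (\<Sum>u\<in>U. Poly_Mapping.lookup (right_coord i u p * left_coord i (rest i (- u + z)) q)
                       (front i (- u + z)))"
  proof (rule sum.cong)
    fix u assume u: "u \<in> U"
    have "Poly_Mapping.keys (right_coord i u p) \<subseteq> ?G"
    proof
      fix g assume "g \<in> Poly_Mapping.keys (right_coord i u p)"
      then have "u + letter i g \<in> Poly_Mapping.keys p" by (simp add: in_keys_iff)
      moreover have "rear i (u + letter i g) = g" using u assms by (simp add: init_plus_letter)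
      ultimately show "g \<in> ?G" by (metis imageI)
    qed
    moreover have "letter i (- g + front i (- u + z)) + rest i (- u + z) = - (u + letter i g) + z" for g
    proof -
      have "letter i (- g + front i (- u + z)) + rest i (- u + z)
          = - letter i g + (letter i (front i (- u + z)) + rest i (- u + z))"
        by (simp add: letter_add letter_uminus add.assoc)
      also have "\<dots> = - (u + letter i g) + z" by (simp add: front_rest minus_add add.assoc del: add_uminus_conv_diff)
      finally show ?thesis .
    qed
    ultimately show "(\<Sum>g\<in>?G. Poly_Mapping.lookup p (u + letter i g)
                      * Poly_Mapping.lookup q (- (u + letter i g) + z))
        = Poly_Mapping.lookup (right_coord i u p * left_coord i (rest i (- u + z)) q)
            (front i (- u + z))"
      by (subst lookup_mult_group[of ?G]) auto
  qed simp
  finally show ?thesis .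
qed

section \<open>Descent in the group ring of a free product\<close>

text \<open>The element of the factor ring that stands between \<open>u\<close> and \<open>y\<close>
  in \<open>p * v + q * w\<close>: the row of right coordinates at \<open>u\<close> applied to the
  column of left coordinates at \<open>y\<close>.\<close>

definition pairing where
  "pairing i p q v w u y = right_coord i u p * left_coord i y v + right_coord i u q * left_coord i y w"

lemma lookup_pairing:
  assumes "finite U" "\<And>u. u \<in> U \<Longrightarrow> \<not> ends i u"
    "init i ` (Poly_Mapping.keys p \<union> Poly_Mapping.keys q) \<subseteq> U"
  shows "Poly_Mapping.lookup (p * v + q * w) z
           = (\<Sum>u\<in>U. Poly_Mapping.lookup (pairing i p q v w u (rest i (- u + z))) (front i (- u + z)))"
  using assms
  by (simp add: lookup_add pairing_def sum.distrib lookup_mult_coords[of U i] image_Un)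

lemma right_coord_eq_0:
  assumes "\<not> ends i u" "u \<notin> init i ` Poly_Mapping.keys p"
  shows "right_coord i u p = 0"
proof (rule poly_mapping_eqI)
  fix g
  have "u + letter i g \<notin> Poly_Mapping.keys p"
    using assms init_plus_letter(1)[OF assms(1), of g] by (metis imageI)
  then show "Poly_Mapping.lookup (right_coord i u p) g = Poly_Mapping.lookup 0 g"
    by (simp add: in_keys_iff)
qed

lemma left_coord_eq_0:
  assumes "\<not> starts i w" "w \<notin> rest i ` Poly_Mapping.keys p"
  shows "left_coord i w p = 0"
proof (rule poly_mapping_eqI)
  fix g
  have "letter i g + w \<notin> Poly_Mapping.keys p"
    using assms rest_letter_plus[OF assms(1), of g] by (metis imageI)
  then show "Poly_Mapping.lookup (left_coord i w p) g = Poly_Mapping.lookup 0 g"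
    by (simp add: in_keys_iff)
qed

definition supp where
  "supp i v w = {y. \<not> starts i y \<and> (left_coord i y v \<noteq> 0 \<or> left_coord i y w \<noteq> 0)}"

lemma finite_supp: "finite (supp i v w)"
  by (rule finite_subset[of _ "rest i ` (Poly_Mapping.keys v \<union> Poly_Mapping.keys w)"])
     (use left_coord_eq_0 in \<open>auto simp: supp_def image_Un\<close>)

text \<open>The word \<open>z\<close> is the product of \<open>u\<close>, an element of the
  \<open>i\<close>-th factor and a rest, so the middle adds at most one letter. Length
  \<open>Suc D\<close> is reached only if the middle is nontrivial and the outer parts have total
  length \<open>D\<close>; then all three parts are visible in \<open>z\<close>.\<close>

lemma wlen_front_rest:
  assumes "\<not> ends i u" "wlen u + wlen (rest i (- u + z)) \<le> D"
  shows "wlen z \<le> Suc D"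
    and "wlen z = Suc D \<Longrightarrow> front i (- u + z) \<noteq> 0 \<and> wlen u + wlen (rest i (- u + z)) = D \<and>
           letters z = letters u @ (i, front i (- u + z)) # letters (rest i (- u + z))"
proof -
  let ?h = "front i (- u + z)" and ?y = "rest i (- u + z)"
  have z: "z = u + letter i ?h + ?y"
    by (simp add: front_rest add.assoc)
  have *: "letters z = letters u @ (i, ?h) # letters ?y" if "?h \<noteq> 0"
    by (subst z) (use that assms not_starts_rest in \<open>intro letters_plus_letter_plus; simp\<close>)
  have **: "wlen z \<le> D" if "?h = 0"
  proof -
    have "z = u + ?y" using z that by (metis add.right_neutral letter_0)
    then show ?thesis using wlen_plus[of u ?y] assms by simp
  qed
  show "wlen z \<le> Suc D"
    using * ** assms by (cases "?h = 0") (auto simp: wlen_def)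
  show "wlen z = Suc D \<Longrightarrow> ?h \<noteq> 0 \<and> wlen u + wlen ?y = D \<and> letters z = letters u @ (i, ?h) # letters ?y"
    using * ** assms by (cases "?h = 0") (auto simp: wlen_def)
qed

text \<open>The measure that decreases in the descent, in the multiset order.\<close>

definition lengths where
  "lengths I v w = (\<Sum>i\<in>I. image_mset wlen (mset_set (supp i (v i) (w i))))"

text \<open>The cofactor of the prefix \<open>x\<close> in \<open>p\<close>. It is applied with
  \<open>x\<close> ending in a letter of type \<open>i\<close>; a word starting with this type would
  merge with \<open>x\<close> instead of following it and is left out.\<close>

definition strip where
  "strip i x p = restr (\<lambda>y. \<not> starts i y) (Poly_Mapping.map_key ((+) x) p)"

lemma lookup_strip:
  fixes p :: "'a::group_add free_product \<Rightarrow>\<^sub>0 int"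
  shows "Poly_Mapping.lookup (strip i x p) y = (if starts i y then 0 else Poly_Mapping.lookup p (x + y))"
  by (simp add: strip_def lookup_map_key inj_on_def)

lemma not_starts_plus_letter:
  assumes "\<not> starts i u" "\<not> ends j u" "j \<noteq> i"
  shows "\<not> starts i (u + letter j g)"
proof (cases "g = 0")
  case False
  then show ?thesis using assms
    by (cases "letters u") (auto simp: starts_def letters_plus_letter)
qed (use assms in simp)

lemma mult_less_than_lengths:
  fixes New Old :: "'a set" and f :: "'a \<Rightarrow> nat"
  assumes "finite New" "finite Old" "y0 \<in> Old" "f y0 = d"
    and le: "\<And>y. y \<in> New \<Longrightarrow> f y \<le> d"
    and top: "\<And>y. y \<in> New \<Longrightarrow> f y = d \<Longrightarrow> y \<in> Old \<and> y \<noteq> y0"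
  shows "(R + image_mset f (mset_set New), R + image_mset f (mset_set Old)) \<in> mult less_than"
proof -
  \<comment> \<open>The longest members of \<open>New\<close> are common to both sets; after their
    removal \<open>y0\<close> remains in \<open>Old\<close> and is longer than everything left in
    \<open>New\<close>.\<close>
  define C where "C = {y\<in>New. f y = d}"
  have C: "C \<subseteq> New" "C \<subseteq> Old" "y0 \<in> Old - C" using assms by (auto simp: C_def)
  then have fin: "finite C" using assms finite_subset by blast
  have split: "mset_set S = mset_set C + mset_set (S - C)" if "finite S" "C \<subseteq> S" for S
    using that fin mset_set_Union[of C "S - C"] by (simp add: Un_absorb1)
  have "(R + image_mset f (mset_set C) + image_mset f (mset_set (New - C)),
         R + image_mset f (mset_set C) + image_mset f (mset_set (Old - C))) \<in> mult less_than"
  proof (rule one_step_implies_mult)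
    show "image_mset f (mset_set (Old - C)) \<noteq> {#}"
      using C(3) assms by (auto simp: mset_set_empty_iff)
    show "\<forall>k\<in>#image_mset f (mset_set (New - C)). \<exists>j\<in>#image_mset f (mset_set (Old - C)). (k, j) \<in> less_than"
    proof
      fix k assume "k \<in># image_mset f (mset_set (New - C))"
      then obtain y where y: "y \<in> New - C" "k = f y" using assms by auto
      then have "k < d" using le[of y] by (auto simp: C_def)
      moreover have "d \<in># image_mset f (mset_set (Old - C))"
        using C(3) assms by auto
      ultimately show "\<exists>j\<in>#image_mset f (mset_set (Old - C)). (k, j) \<in> less_than" by auto
    qed
  qed
  then show ?thesis
    using split[OF \<open>finite New\<close> C(1)] split[OF \<open>finite Old\<close> C(2)] by (simp add: add.assoc)
qed

lemma single_0_int: "Poly_Mapping.single 0 k = (of_int k :: 'a::monoid_add \<Rightarrow>\<^sub>0 int)"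
  by (rule poly_mapping_eqI) (auto simp: lookup_of_int lookup_single when_def)

lemma emb_of_int [simp]: "emb i (of_int k) = of_int k"
  by (simp flip: single_0_int)

text \<open>Solutions \<open>(v, w)\<close> are the homomorphisms to the ring from the left module
  with two generators and the single relation \<open>(c, d)\<close>; the combinations
  \<open>p1 * v + p2 * w\<close> are their values.\<close>

definition no_scalar_values :: "'r::ring_1 \<Rightarrow> 'r \<Rightarrow> bool" where
  "no_scalar_values c d \<longleftrightarrow>
     (\<forall>p1 p2 v w n. c * v + d * w = 0 \<longrightarrow> p1 * v + p2 * w = of_int n \<longrightarrow> n = 0)"

text \<open>The solutions have rank one, expressed without fractions: a functional that kills one
  nonzero solution kills all of them.\<close>

definition rank_one_kernel :: "'r::ring_1 \<Rightarrow> 'r \<Rightarrow> bool" where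
  "rank_one_kernel c d \<longleftrightarrow>
     (\<forall>p1 p2 v w v' w'. c * v + d * w = 0 \<longrightarrow> c * v' + d * w' = 0 \<longrightarrow>
        p1 * v + p2 * w = 0 \<longrightarrow> v \<noteq> 0 \<or> w \<noteq> 0 \<longrightarrow> p1 * v' + p2 * w' = 0)"

text \<open>One elimination step of the weak algorithm. It multiplies the relation by an integer
  \<open>k\<close> that need not be a unit, so the invariant is a nonzero integer \<open>n\<close>
  and not the value 1.\<close>

lemma descent_step:
  fixes c d :: "'a::group_add \<Rightarrow>\<^sub>0 int" and v w A B :: "nat \<Rightarrow> 'a free_product \<Rightarrow>\<^sub>0 int"
  assumes no_scalar: "no_scalar_values c d" and rank_one: "rank_one_kernel c d"
    and fin: "finite I" and n: "n \<noteq> 0"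
    and ker: "\<And>i. i \<in> I \<Longrightarrow> emb i c * v i + emb i d * w i = 0"
    and eq: "of_int n = (\<Sum>i\<in>I. A i * v i + B i * w i)"
  shows "\<exists>v' w' A' B' n'. n' \<noteq> 0 \<and> (\<forall>i\<in>I. emb i c * v' i + emb i d * w' i = 0) \<and>
           of_int n' = (\<Sum>i\<in>I. A' i * v' i + B' i * w' i) \<and>
           (lengths I v' w', lengths I v w) \<in> mult less_than"
proof -
  define U where "U i = init i ` (Poly_Mapping.keys (A i) \<union> Poly_Mapping.keys (B i))" for i
  define E where "E i = pairing i (A i) (B i) (v i) (w i)" for i
  have U: "finite (U i)" "u \<in> U i \<Longrightarrow> \<not> ends i u" for i u
    by (auto simp: U_def not_ends_init)
  have lookup_E: "Poly_Mapping.lookup (A i * v i + B i * w i) z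
      = (\<Sum>u\<in>U i. Poly_Mapping.lookup (E i u (rest i (- u + z))) (front i (- u + z)))" for i z
    unfolding E_def by (rule lookup_pairing) (use U in \<open>auto simp: U_def\<close>)
  have coord: "c * left_coord i y (v i) + d * left_coord i y (w i) = 0" if "i \<in> I" for i y
    using arg_cong[OF ker[OF that], of "left_coord i y"]
    by (simp add: left_coord_add left_coord_emb_mult)

  \<comment> \<open>The nonzero contributions to the relation: a prefix \<open>u\<close>, the middle
    element \<open>E i u y\<close> of the factor ring, a suffix \<open>y\<close>.\<close>
  define T where "T = {(i, u, y). i \<in> I \<and> u \<in> U i \<and> y \<in> supp i (v i) (w i) \<and> E i u y \<noteq> 0}"
  have "T \<subseteq> Sigma I (\<lambda>i. U i \<times> supp i (v i) (w i))" by (auto simp: T_def)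
  then have finT: "finite T" by (rule finite_subset) (intro finite_SigmaI fin finite_cartesian_product U finite_supp)
  have TI: "(i, u, y) \<in> T" if "i \<in> I" "\<not> ends i u" "\<not> starts i y" "E i u y \<noteq> 0" for i u y
  proof -
    have "right_coord i u (A i) \<noteq> 0 \<or> right_coord i u (B i) \<noteq> 0"
      using that by (auto simp: E_def pairing_def)
    then have "u \<in> U i" using right_coord_eq_0[OF that(2)] by (auto simp: U_def)
    moreover have "y \<in> supp i (v i) (w i)"
      using that by (auto simp: E_def pairing_def supp_def)
    ultimately show ?thesis using that by (simp add: T_def)
  qed
  \<comment> \<open>Without contributions the coefficient at the empty word, which is
    \<open>n\<close>, would vanish.\<close>
  have "T \<noteq> {}"
  proof
    assume "T = {}"
    then have "E i u (rest i z) = 0" if "i \<in> I" "u \<in> U i" for i u z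
      using TI[of i u "rest i z"] U that not_starts_rest by blast
    then have "Poly_Mapping.lookup (\<Sum>i\<in>I. A i * v i + B i * w i) 0 = 0"
      by (simp add: lookup_sum lookup_E)
    then show False using n by (simp flip: eq add: lookup_of_int)
  qed
  define size2 where "size2 = (\<lambda>(i :: nat, u :: 'a free_product, y :: 'a free_product). wlen u + wlen y)"
  define D where "D = Max (size2 ` T)"
  have D: "size2 t \<le> D" if "t \<in> T" for t using finT that by (simp add: D_def)
  have "D \<in> size2 ` T" using finT \<open>T \<noteq> {}\<close> by (simp add: D_def)
  then have T': "finite {t\<in>T. size2 t = D}" "{t\<in>T. size2 t = D} \<noteq> {}" using finT by auto
  define e where "e = Max ((\<lambda>(i, u, y). wlen y) ` {t\<in>T. size2 t = D})"
  have e: "wlen y \<le> e" if "(i, u, y) \<in> T" "wlen u + wlen y = D" for i u y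
  proof -
    have "(\<lambda>(i, u, y). wlen y) (i, u, y) \<le> e"
      unfolding e_def using T' that by (intro Max_ge imageI finite_imageI) (auto simp: size2_def)
    then show ?thesis by simp
  qed
  have "e \<in> (\<lambda>(i, u, y). wlen y) ` {t\<in>T. size2 t = D}"
    unfolding e_def using T' by (intro Max_in) auto
  \<comment> \<open>Among the contributions to the longest words choose one with the longest right part \<open>y0\<close>. All
    other contributions to words that start with \<open>u0\<close> and a letter of type \<open>i\<close> then come from
    solutions with shorter leading words.\<close>
  then obtain i u0 y0 where iuy: "(i, u0, y0) \<in> T" "wlen u0 + wlen y0 = D" "wlen y0 = e"
    by (auto simp: size2_def)
  have i: "i \<in> I" and u0: "u0 \<in> U i" "\<not> ends i u0" and y0: "y0 \<in> supp i (v i) (w i)" "\<not> starts i y0"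
    and E0: "E i u0 y0 \<noteq> 0"
    using iuy(1) U by (auto simp: T_def supp_def)
  have bound: "wlen u + wlen y \<le> D" "wlen u + wlen y = D \<Longrightarrow> wlen y \<le> e"
    if "j \<in> I" "\<not> ends j u" "\<not> starts j y" "E j u y \<noteq> 0" for j u y
    using D[OF TI[OF that]] e[OF TI[OF that]] by (auto simp: size2_def)
  \<comment> \<open>All columns of coordinates solve the equation over the factor ring; by rank one,
    a row that kills the nonzero column at \<open>y\<close> kills every column of this
    solution.\<close>
  have E_supp: "E i u y = 0 \<Longrightarrow> E i u y' = 0" if "y \<in> supp i (v i) (w i)" for u y y'
    using rank_one coord[OF i] that unfolding rank_one_kernel_def E_def pairing_def supp_def by blast
  \<comment> \<open>The row at \<open>u0\<close> thus kills no column in the support, and the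
    maximality of \<open>D\<close> bounds the lengths of all \<open>y\<close> there by
    \<open>e\<close>.\<close>
  have supp_le: "wlen y \<le> e" if "y \<in> supp i (v i) (w i)" for y
  proof -
    have "E i u0 y \<noteq> 0" using E_supp[OF that] E0 by blast
    then show ?thesis using bound[OF i u0(2), of y] that iuy by (auto simp: supp_def)
  qed

  \<comment> \<open>Some nontrivial letter occurs in the middle: otherwise \<open>E i u0 y0\<close>
    would be a nonzero integer value of a functional on a solution.\<close>
  obtain g where g: "g \<noteq> 0" "Poly_Mapping.lookup (E i u0 y0) g \<noteq> 0"
  proof (rule ccontr)
    assume "\<not> thesis"
    with that have "Poly_Mapping.lookup (E i u0 y0) g = 0" if "g \<noteq> 0" for g using that by blast
    then have *: "E i u0 y0 = of_int (Poly_Mapping.lookup (E i u0 y0) 0)"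
      by (intro poly_mapping_eqI) (simp add: lookup_of_int when_def)
    have "Poly_Mapping.lookup (E i u0 y0) 0 = 0"
      using coord[OF i, of y0] * no_scalar unfolding no_scalar_values_def E_def pairing_def by blast
    then show False using * E0 by simp
  qed
  define k where "k = Poly_Mapping.lookup (E i u0 y0) g"
  \<comment> \<open>For \<open>y\<close> of length \<open>e\<close> not starting with type
    \<open>i\<close>, the word \<open>x + y\<close> has length \<open>Suc D\<close>. Comparing the
    coefficients at these words yields the elimination.\<close>
  define x where "x = u0 + letter i g"
  have letters_x: "letters x = letters u0 @ [(i, g)]"
    using g u0 by (simp add: x_def letters_plus_letter)
  have letters_xy: "letters (x + y) = letters x @ letters y" if "\<not> starts i y" for y
    using letters_plus_letter_plus[OF u0(2) that g(1)] by (simp add: letters_x) (simp add: x_def)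
  have wlen_xy: "wlen (x + y) = Suc (wlen u0 + wlen y)" if "\<not> starts i y" for y
    using letters_xy[OF that] by (simp add: wlen_def letters_x)

  \<comment> \<open>The part of the relation behind \<open>x\<close> that comes from the other
    factors. It is still a left combination of the old \<open>v j\<close> and \<open>w j\<close>, so
    multiples of \<open>Q\<close> can be absorbed into their coefficients.\<close>
  define Q where "Q = (\<Sum>j\<in>I - {i}. strip i x (A j) * v j + strip i x (B j) * w j)"
  \<comment> \<open>At length \<open>e\<close>, stripping only the coefficients agrees with
    stripping the whole product. At greater lengths, and at words of length \<open>e\<close>
    starting with type \<open>i\<close>, nothing arises.\<close>
  have strip_sum:
    "(wlen y > e \<or> starts i y \<longrightarrow>
        Poly_Mapping.lookup (strip i x (A j) * v j + strip i x (B j) * w j) y = 0) \<and>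
     (wlen y = e \<and> \<not> starts i y \<longrightarrow>
        Poly_Mapping.lookup (strip i x (A j) * v j + strip i x (B j) * w j) y
          = Poly_Mapping.lookup (A j * v j + B j * w j) (x + y))"
    if j: "j \<in> I" "j \<noteq> i" and ye: "wlen y \<ge> e" for j y
  proof -
    define U' where "U' = {u. \<not> ends j u \<and> \<not> starts i u \<and> x + u \<in> U j}"
    have "U' \<subseteq> (\<lambda>u. - x + u) ` U j"
    proof
      fix u assume "u \<in> U'"
      then have "x + u \<in> U j" by (simp add: U'_def)
      moreover have "u = - x + (x + u)" by (simp flip: add.assoc)
      ultimately show "u \<in> (\<lambda>u. - x + u) ` U j" by blast
    qed
    then have finU': "finite U'" using U finite_subset by blast
    have ends_xu: "\<not> ends j (x + u)" if "\<not> ends j u" "\<not> starts i u" for u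
      using that j by (cases "letters u") (auto simp: ends_def letters_xy letters_x)
    have cover: "init j y' \<in> U'" if "y' \<in> Poly_Mapping.keys (strip i x p)"
      and p: "p = A j \<or> p = B j" for y' p
    proof -
      from that have y': "\<not> starts i y'" "x + y' \<in> Poly_Mapping.keys p"
        by (auto simp: in_keys_iff lookup_strip split: if_splits)
      let ?u = "init j y'"
      have split: "y' = ?u + letter j (rear j y')" by (simp add: init_rear)
      have "\<not> starts i ?u"
      proof (cases "rear j y' = 0")
        case True
        then show ?thesis using split y' by (metis add.right_neutral letter_0)
      next
        case False
        then have "letters y' = letters ?u @ [(j, rear j y')]"
          using letters_plus_letter[OF not_ends_init[of j y'] False] by (simp add: init_rear)
        then show ?thesis using y'(1) by (auto simp: starts_def hd_append)
      qed
      moreover have "init j (x + y') = x + ?u"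
        using init_plus_letter(1)[OF ends_xu[OF not_ends_init[of j y'] \<open>\<not> starts i ?u\<close>], of "rear j y'"]
        by (simp add: add.assoc init_rear)
      then have "x + ?u \<in> U j" using y'(2) p unfolding U_def by force
      ultimately show ?thesis by (simp add: U'_def not_ends_init)
    qed
    have strip_pairing: "pairing j (strip i x (A j)) (strip i x (B j)) (v j) (w j) u y' = E j (x + u) y'"
      if "u \<in> U'" for u y'
    proof -
      have "right_coord j u (strip i x p) = right_coord j (x + u) p" for p :: "'a free_product \<Rightarrow>\<^sub>0 int"
        using that j not_starts_plus_letter[of i u j]
        by (intro poly_mapping_eqI) (simp add: lookup_strip U'_def add.assoc)
      then show ?thesis by (simp add: pairing_def E_def)
    qed
    have sum1: "Poly_Mapping.lookup (strip i x (A j) * v j + strip i x (B j) * w j) y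
        = (\<Sum>u\<in>U'. Poly_Mapping.lookup (E j (x + u) (rest j (- u + y))) (front j (- u + y)))"
      by (subst lookup_pairing[of U' j]) (use finU' cover strip_pairing in \<open>auto simp: U'_def\<close>)
    \<comment> \<open>As \<open>x\<close> is one letter longer than \<open>u0\<close>, at most
      \<open>e - 1\<close> letters are left for \<open>u\<close> and \<open>?r\<close>. Length
      \<open>e\<close> therefore requires a middle letter of type \<open>j\<close>, and the word
      starts with it or with the first letter of \<open>u\<close>, neither of type
      \<open>i\<close>.\<close>
    have small: "wlen y = e \<and> \<not> starts i y"
      if u: "u \<in> U'" "Poly_Mapping.lookup (E j (x + u) (rest j (- u + y))) (front j (- u + y)) \<noteq> 0" for u
    proof -
      let ?r = "rest j (- u + y)"
      have u': "\<not> ends j u" "\<not> starts i u" using u by (auto simp: U'_def)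
      have "E j (x + u) ?r \<noteq> 0" using u by auto
      then have "wlen (x + u) + wlen ?r \<le> D"
        using bound(1) j ends_xu[OF u'] not_starts_rest by blast
      then have le: "Suc (wlen u + wlen ?r) \<le> e" using wlen_xy[OF u'(2)] iuy by simp
      then have "wlen u + wlen ?r \<le> e - 1" by simp
      note K = wlen_front_rest[OF u'(1) this]
      have "wlen y = e" using K(1) ye le by simp
      with K(2) le have "letters y = letters u @ (j, front j (- u + y)) # letters ?r" by simp
      then have "\<not> starts i y" using j u' by (cases "letters u") (auto simp: starts_def)
      with \<open>wlen y = e\<close> show ?thesis by simp
    qed
    have "Poly_Mapping.lookup (strip i x (A j) * v j + strip i x (B j) * w j) y = 0"
      if "wlen y > e \<or> starts i y"
      unfolding sum1 by (rule sum.neutral) (use small that in auto)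
    moreover have "Poly_Mapping.lookup (strip i x (A j) * v j + strip i x (B j) * w j) y
          = Poly_Mapping.lookup (A j * v j + B j * w j) (x + y)" if y: "wlen y = e" "\<not> starts i y"
    proof -
      \<comment> \<open>A prefix \<open>u\<close> contributing to \<open>x + y\<close> must extend
        \<open>x\<close>. If its suffix had length \<open>e\<close>, the middle letter of type
        \<open>j\<close> would lie where \<open>x\<close> has its last letter, of type
        \<open>i\<close>; so the suffix is shorter and \<open>u\<close> covers
        \<open>x\<close>.\<close>
      have zero: "u \<in> (+) x ` U'" if u: "u \<in> U j"
        "Poly_Mapping.lookup (E j u (rest j (- u + (x + y)))) (front j (- u + (x + y))) \<noteq> 0" for u
      proof -
        let ?r = "rest j (- u + (x + y))" and ?h = "front j (- u + (x + y))"
        have u': "\<not> ends j u" and Er: "E j u ?r \<noteq> 0" using u U by auto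
        note b = bound[OF j(1) u' not_starts_rest Er]
        have "wlen (x + y) = Suc D" using wlen_xy[OF y(2)] y iuy by simp
        note K = wlen_front_rest(2)[OF u' b(1) this]
        then have r: "wlen ?r \<le> e" "wlen u + wlen ?r = D" using b(2) by auto
        have l: "letters x @ letters y = letters u @ (j, ?h) # letters ?r"
          using K letters_xy[OF y(2)] by simp
        have "wlen ?r \<noteq> e"
        proof
          assume "wlen ?r = e"
          then have "letters x = letters u @ [(j, ?h)]"
            using l y(1) append_eq_append_conv[of "letters x" "letters u @ [(j, ?h)]" "letters y" "letters ?r"]
            by (simp add: wlen_def)
          then show False using letters_x j by simp
        qed
        then have le_length: "length (letters x) \<le> length (letters u)"
          using r iuy by (simp add: wlen_def letters_x)
        obtain us where us: "letters u = letters x @ us" "letters y = us @ (j, ?h) # letters ?r"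
        proof -
          from l obtain us where "letters x = letters u @ us \<and> us @ letters y = (j, ?h) # letters ?r \<or>
              letters x @ us = letters u \<and> letters y = us @ (j, ?h) # letters ?r"
            unfolding append_eq_append_conv2 by blast
          then show thesis using le_length that by (cases us) (auto dest: sym)
        qed
        have red: "reduced us" using reduced_letters[of u] by (simp add: us reduced_append)
        define u1 where "u1 = Abs_free_product us"
        have u1: "letters u1 = us" using red by (simp add: u1_def Abs_free_product_inverse)
        have st: "\<not> starts i u1" using y(2) us by (cases us) (auto simp: starts_def u1)
        have "x + u1 = u" using letters_xy[OF st] us u1 by (simp flip: letters_inject)
        moreover have "\<not> ends j u1" using u' us by (cases us) (auto simp: ends_def u1)
        ultimately show ?thesis using st u by (auto simp: U'_def)
      qed
      have "Poly_Mapping.lookup (A j * v j + B j * w j) (x + y)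
          = (\<Sum>u\<in>(+) x ` U'. Poly_Mapping.lookup (E j u (rest j (- u + (x + y)))) (front j (- u + (x + y))))"
        unfolding lookup_E using U zero
        by (intro sum.mono_neutral_right) (auto simp: U'_def)
      also have "\<dots> = (\<Sum>u\<in>U'. Poly_Mapping.lookup (E j (x + u) (rest j (- u + y))) (front j (- u + y)))"
      proof -
        have "- (x + u) + (x + y) = - u + y" for u
          by (simp add: minus_add add.assoc del: add_uminus_conv_diff)
        then show ?thesis by (subst sum.reindex) (auto simp: inj_on_def)
      qed
      finally show ?thesis by (simp add: sum1)
    qed
    ultimately show ?thesis by blast
  qed
  have Q_0: "Poly_Mapping.lookup Q y = 0" if "wlen y \<ge> e" "wlen y > e \<or> starts i y" for y
    unfolding Q_def lookup_sum by (rule sum.neutral) (use strip_sum that in blast)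
  have Q_top: "Poly_Mapping.lookup Q y = - Poly_Mapping.lookup (E i u0 y) g"
    if y: "wlen y = e" "\<not> starts i y" for y
  proof -
    \<comment> \<open>By rank one such a \<open>u\<close> also contributes together with
      \<open>y0\<close>, hence is not longer than \<open>u0\<close>. Its suffix then has length
      exactly \<open>e\<close>, and comparing the two spellings of \<open>x + y\<close> gives
      \<open>u = u0\<close>.\<close>
    have only: "u = u0" if u: "u \<in> U i"
        "Poly_Mapping.lookup (E i u (rest i (- u + (x + y)))) (front i (- u + (x + y))) \<noteq> 0" for u
    proof -
      let ?r = "rest i (- u + (x + y))" and ?h = "front i (- u + (x + y))"
      have u': "\<not> ends i u" and Er: "E i u ?r \<noteq> 0" using u U by auto
      note b = bound[OF i u' not_starts_rest Er]
      have "wlen (x + y) = Suc D" using wlen_xy[OF y(2)] y iuy by simp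
      note K = wlen_front_rest(2)[OF u' b(1) this]
      have "E i u y0 \<noteq> 0" using E_supp[OF y0(1)] Er by blast
      then have "wlen u \<le> wlen u0" using bound(1)[OF i u' y0(2)] iuy by simp
      moreover have "wlen u + wlen ?r = D" using K by blast
      ultimately have "wlen ?r = e" using b(2) iuy(2,3) by simp
      then have "letters x = letters u @ [(i, ?h)]"
        using K letters_xy[OF y(2)] y(1)
          append_eq_append_conv[of "letters x" "letters u @ [(i, ?h)]" "letters y" "letters ?r"]
        by (simp add: wlen_def)
      then show "u = u0" using letters_x by (simp add: letters_inject)
    qed
    have "Poly_Mapping.lookup (A i * v i + B i * w i) (x + y)
        = (\<Sum>u\<in>{u0}. Poly_Mapping.lookup (E i u (rest i (- u + (x + y)))) (front i (- u + (x + y))))"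
      unfolding lookup_E by (intro sum.mono_neutral_right) (use U(1) u0(1) only in blast)+
    also have "\<dots> = Poly_Mapping.lookup (E i u0 y) g"
    proof -
      have "- u0 + (x + y) = letter i g + y" by (simp add: x_def flip: add.assoc)
      then show ?thesis using y by (simp add: front_letter_plus rest_letter_plus)
    qed
    finally have 1: "Poly_Mapping.lookup (A i * v i + B i * w i) (x + y) = Poly_Mapping.lookup (E i u0 y) g" .
    \<comment> \<open>The value \<open>n\<close> of the relation is supported at the empty word, so
      the contributions at \<open>x + y\<close> cancel.\<close>
    have "x + y \<noteq> 0"
      using letters_xy[OF y(2)] letters_x by auto
    then have "0 = Poly_Mapping.lookup (\<Sum>j\<in>I. A j * v j + B j * w j) (x + y)"
      by (simp flip: eq add: lookup_of_int)
    also have "\<dots> = Poly_Mapping.lookup (E i u0 y) g + Poly_Mapping.lookup Q y"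
    proof -
      have "Poly_Mapping.lookup Q y = (\<Sum>j\<in>I - {i}. Poly_Mapping.lookup (A j * v j + B j * w j) (x + y))"
        unfolding Q_def lookup_sum by (rule sum.cong) (use strip_sum[of _ y] y in simp_all)
      then show ?thesis
        by (simp only: lookup_sum sum.remove[OF fin i, of "\<lambda>j. Poly_Mapping.lookup (A j * v j + B j * w j) (x + y)"] 1)
    qed
    finally show ?thesis by simp
  qed
  \<comment> \<open>A nontrivial letter in front of \<open>y\<close> would give a word longer than
    \<open>e\<close>, where \<open>Q\<close> vanishes; so these coordinates of \<open>Q\<close> are
    integers.\<close>
  have coord_Q: "left_coord i y Q = (if wlen y = e then - of_int (Poly_Mapping.lookup (E i u0 y) g) else 0)"
    if y: "wlen y \<ge> e" "\<not> starts i y" for y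
  proof (rule poly_mapping_eqI)
    fix h
    show "Poly_Mapping.lookup (left_coord i y Q) h
      = Poly_Mapping.lookup (if wlen y = e then - of_int (Poly_Mapping.lookup (E i u0 y) g) else 0) h"
    proof (cases "h = 0")
      case True
      then show ?thesis using Q_top[of y] Q_0[of y] y by (auto simp: lookup_of_int)
    next
      case False
      then have "wlen (letter i h + y) = Suc (wlen y)"
        using y by (simp add: wlen_def letters_letter_plus_reduced)
      then show ?thesis using Q_0[of "letter i h + y"] y False by (simp add: lookup_of_int)
    qed
  qed

  \<comment> \<open>The column at \<open>y0\<close> is itself a solution. Its right multiple by
    \<open>Q\<close>, added to \<open>k\<close> times the old solution, cancels the coordinates at
    \<open>y0\<close>, because the coordinate of \<open>Q\<close> there is
    \<open>- k\<close>.\<close>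
  define lv lw where "lv = emb i (left_coord i y0 (v i))" and "lw = emb i (left_coord i y0 (w i))"
  define v' where "v' = v(i := of_int k * v i + lv * Q)"
  define w' where "w' = w(i := of_int k * w i + lw * Q)"
  define Z where "Z = A i * lv + B i * lw"
  \<comment> \<open>The change of \<open>v i\<close> and \<open>w i\<close> adds
    \<open>Z * Q\<close> to the relation; the new coefficients of the other factors subtract it
    again.\<close>
  define A' where "A' j = (if j = i then A i else of_int k * A j - Z * strip i x (A j))" for j
  define B' where "B' j = (if j = i then B i else of_int k * B j - Z * strip i x (B j))" for j
  have comm: "p * of_int m = of_int m * p" for p :: "'a free_product \<Rightarrow>\<^sub>0 int" and m
    by (simp add: mult_of_int_commute)
  have emb_mult: "emb i (p * q) = emb i p * emb i q" for p q
    by (rule push_forward_mult) (rule letter_add)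
  have left_coord_new: "left_coord i y (of_int k * q + emb i p * Q) = of_int k * left_coord i y q + p * left_coord i y Q"
    for p q y
  proof -
    have "of_int k * q = emb i (of_int k) * q" by simp
    then show ?thesis
      by (metis left_coord_add left_coord_emb_mult)
  qed
  have ker': "emb j c * v' j + emb j d * w' j = 0" if "j \<in> I" for j
  proof (cases "j = i")
    case True
    have "emb i c * v' i + emb i d * w' i
        = of_int k * (emb i c * v i + emb i d * w i) + (emb i c * lv + emb i d * lw) * Q"
    proof -
      have "p * (of_int k * q) = of_int k * (p * q)" for p q :: "'a free_product \<Rightarrow>\<^sub>0 int"
        by (metis comm mult.assoc)
      then show ?thesis by (simp add: v'_def w'_def algebra_simps)
    qed
    also have "emb i c * lv + emb i d * lw = emb i (c * left_coord i y0 (v i) + d * left_coord i y0 (w i))"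
      by (simp add: lv_def lw_def push_forward_add emb_mult)
    finally show ?thesis using True ker[OF i] coord[OF i] by simp
  qed (use ker that in \<open>simp add: v'_def w'_def\<close>)
  have eq': "of_int (k * n) = (\<Sum>j\<in>I. A' j * v' j + B' j * w' j)"
  proof -
    have "(\<Sum>j\<in>I. A' j * v' j + B' j * w' j)
        = (A i * (of_int k * v i + lv * Q) + B i * (of_int k * w i + lw * Q))
          + (\<Sum>j\<in>I - {i}. of_int k * (A j * v j + B j * w j)
               - Z * (strip i x (A j) * v j + strip i x (B j) * w j))"
      unfolding sum.remove[OF fin i]
      by (intro arg_cong2[of _ _ _ _ "(+)"] sum.cong) (auto simp: A'_def B'_def v'_def w'_def algebra_simps)
    also have "\<dots> = of_int k * (A i * v i + B i * w i) + Z * Q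
          + (of_int k * (\<Sum>j\<in>I - {i}. A j * v j + B j * w j) - Z * Q)"
    proof -
      have "p * (of_int k * q) = of_int k * (p * q)" for p q :: "'a free_product \<Rightarrow>\<^sub>0 int"
        by (metis comm mult.assoc)
      then have "A i * (of_int k * v i + lv * Q) + B i * (of_int k * w i + lw * Q)
          = of_int k * (A i * v i + B i * w i) + Z * Q"
        by (simp add: Z_def algebra_simps)
      then show ?thesis by (simp add: sum_subtractf Q_def flip: sum_distrib_left)
    qed
    also have "\<dots> = of_int k * (\<Sum>j\<in>I. A j * v j + B j * w j)"
      unfolding sum.remove[OF fin i] by (simp add: algebra_simps)
    finally show ?thesis by (simp flip: eq)
  qed
  have less: "(lengths I v' w', lengths I v w) \<in> mult less_than"
  proof -
    define R where "R = (\<Sum>j\<in>I - {i}. image_mset wlen (mset_set (supp j (v j) (w j))))"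
    have "lengths I v w = R + image_mset wlen (mset_set (supp i (v i) (w i)))"
      by (simp add: lengths_def R_def sum.remove[OF fin i] add.commute)
    moreover have "lengths I v' w' = R + image_mset wlen (mset_set (supp i (v' i) (w' i)))"
      by (simp add: lengths_def R_def sum.remove[OF fin i] add.commute v'_def w'_def)
    moreover have "wlen y \<le> e \<and> (wlen y = e \<longrightarrow> y \<in> supp i (v i) (w i) \<and> y \<noteq> y0)"
      if y: "y \<in> supp i (v' i) (w' i)" for y
    proof -
      have st: "\<not> starts i y" using y by (simp add: supp_def)
      have new: "left_coord i y (v' i) = of_int k * left_coord i y (v i) + left_coord i y0 (v i) * left_coord i y Q"
        "left_coord i y (w' i) = of_int k * left_coord i y (w i) + left_coord i y0 (w i) * left_coord i y Q"
        by (simp_all add: v'_def w'_def lv_def lw_def left_coord_new)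
      show ?thesis
      proof (cases "y \<in> supp i (v i) (w i)")
        case True
        moreover have "y \<noteq> y0"
        proof
          assume "y = y0"
          moreover have "left_coord i y0 Q = - of_int k"
            using coord_Q[OF _ y0(2)] iuy by (simp add: k_def)
          ultimately have "left_coord i y (v' i) = 0" "left_coord i y (w' i) = 0"
            unfolding new by (simp_all add: mult_of_int_commute)
          then show False using y by (simp add: supp_def)
        qed
        ultimately show ?thesis using supp_le by blast
      next
        case False
        then have 0: "left_coord i y (v i) = 0" "left_coord i y (w i) = 0" using st by (auto simp: supp_def)
        \<comment> \<open>Outside the old support there is no column at \<open>y\<close>, so
          \<open>Q\<close> has no coordinate of length \<open>e\<close> or more there that could
          enlarge the support.\<close>
        then have "E i u0 y = 0" by (simp add: E_def pairing_def)
        then have "left_coord i y Q = 0" if "wlen y \<ge> e" using coord_Q[OF that st] by simp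
        then have "wlen y < e" using y new 0 by (force simp: supp_def)
        then show ?thesis by simp
      qed
    qed
    ultimately show ?thesis
      using mult_less_than_lengths[where f = wlen and d = e, OF finite_supp finite_supp y0(1) iuy(3)] by simp
  qed
  have "k * n \<noteq> 0" using g n by (simp add: k_def)
  then show ?thesis using ker' eq' less by blast
qed

text \<open>A nonzero \<open>n\<close> could be carried down by \<open>descent_step\<close> without
  end, against the well-foundedness of the multiset order. The coefficients and \<open>n\<close>
  change on the way and are therefore quantified inside the induction.\<close>

lemma no_scalar_in_span:
  fixes c d :: "'a::group_add \<Rightarrow>\<^sub>0 int" and v w A B :: "nat \<Rightarrow> 'a free_product \<Rightarrow>\<^sub>0 int"
  assumes no_scalar: "no_scalar_values c d" and rank_one: "rank_one_kernel c d"
    and fin: "finite I"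
    and ker: "\<And>i. i \<in> I \<Longrightarrow> emb i c * v i + emb i d * w i = 0"
    and eq: "of_int n = (\<Sum>i\<in>I. A i * v i + B i * w i)"
  shows "n = 0"
proof -
  have "wf (inv_image (mult less_than) (\<lambda>(v, w). lengths I v w))"
    by (intro wf_inv_image wf_mult wf_less_than)
  then have "\<forall>A B n. (\<forall>i\<in>I. emb i c * fst vw i + emb i d * snd vw i = 0) \<longrightarrow>
      of_int n = (\<Sum>i\<in>I. A i * fst vw i + B i * snd vw i) \<longrightarrow> n = 0"
    for vw :: "(nat \<Rightarrow> 'a free_product \<Rightarrow>\<^sub>0 int) \<times> (nat \<Rightarrow> 'a free_product \<Rightarrow>\<^sub>0 int)"
  proof (induction vw)
    case (less vw)
    obtain v w where vw: "vw = (v, w)" by fastforce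
    show ?case
    proof (intro allI impI, rule ccontr)
      fix A B and n :: int
      assume "\<forall>i\<in>I. emb i c * fst vw i + emb i d * snd vw i = 0"
        and "of_int n = (\<Sum>i\<in>I. A i * fst vw i + B i * snd vw i)" and "n \<noteq> 0"
      then obtain v' w' A' B' n' where "n' \<noteq> 0" "\<forall>i\<in>I. emb i c * v' i + emb i d * w' i = 0"
        "of_int n' = (\<Sum>i\<in>I. A' i * v' i + B' i * w' i)"
        and "(lengths I v' w', lengths I v w) \<in> mult less_than"
        using descent_step[OF no_scalar rank_one fin, where n=n and v=v and w=w and A=A and B=B] by (auto simp: vw)
      then show False using less[of "(v', w')"] by (auto simp: vw)
    qed
  qed
  from this[of "(v, w)"] show ?thesis using ker eq by simp
qed

section \<open>The group ring of the Klein bottle group\<close>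

text \<open>The Klein bottle group: \<open>Klein a m\<close> stands for \<open>x\<^sup>a y\<^sup>m\<close>, where \<open>y x y\<^sup>-\<^sup>1 = x\<^sup>-\<^sup>1\<close>.\<close>

datatype klein = Klein (xpart: int) (ypart: int)

instance klein :: countable
  by countable_datatype

text \<open>The sign by which the \<open>m\<close>-th power of \<open>y\<close> acts on exponents of
  \<open>x\<close>.\<close>

definition flip :: "int \<Rightarrow> int" where
  "flip m = (if even m then 1 else - 1)"

lemma flip_simps [simp]: "flip 0 = 1" "flip 1 = - 1" "flip (- m) = flip m" "flip m * flip m = 1"
  by (simp_all add: flip_def)

lemma flip_add: "flip (m + n) = flip m * flip n"
  by (simp add: flip_def)

instantiation klein :: group_add
begin

definition zero_klein :: klein where "0 = Klein 0 0"
definition plus_klein :: "klein \<Rightarrow> klein \<Rightarrow> klein" where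
  "g + h = Klein (xpart g + flip (ypart g) * xpart h) (ypart g + ypart h)"
definition uminus_klein :: "klein \<Rightarrow> klein" where
  "- g = Klein (- flip (ypart g) * xpart g) (- ypart g)"
definition minus_klein :: "klein \<Rightarrow> klein \<Rightarrow> klein" where
  "g - h = g + - h" for g h :: klein

instance
proof
  fix a b c :: klein
  show "a + b + c = a + (b + c)"
    by (simp add: plus_klein_def flip_add algebra_simps)
qed (simp_all add: zero_klein_def plus_klein_def uminus_klein_def minus_klein_def)

end

lemma klein_simps [simp]:
  "Klein a m + Klein b n = Klein (a + flip m * b) (m + n)"
  "- Klein a m = Klein (- flip m * a) (- m)"
  "Klein a m = 0 \<longleftrightarrow> a = 0 \<and> m = 0" "0 = Klein a m \<longleftrightarrow> a = 0 \<and> m = 0"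
  by (auto simp: plus_klein_def uminus_klein_def zero_klein_def)

section \<open>Leading exponents in the group ring of the Klein bottle group\<close>

lemma in_keys_mult:
  fixes p q :: "'g::group_add \<Rightarrow>\<^sub>0 int"
  assumes "g \<in> Poly_Mapping.keys p" "h \<in> Poly_Mapping.keys q"
    and unique: "\<And>x y. x \<in> Poly_Mapping.keys p \<Longrightarrow> y \<in> Poly_Mapping.keys q \<Longrightarrow> x + y = g + h \<Longrightarrow> x = g"
  shows "g + h \<in> Poly_Mapping.keys (p * q)"
proof -
  \<comment> \<open>Only one pair of support elements adds up to \<open>g + h\<close>, so no
    cancellation can occur.\<close>
  have zero: "Poly_Mapping.lookup p x * Poly_Mapping.lookup q (- x + (g + h)) = 0"
    if "x \<in> Poly_Mapping.keys p - {g}" for x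
    using unique[of x "- x + (g + h)"] that by (force simp: in_keys_iff simp flip: add.assoc)
  have "Poly_Mapping.lookup (p * q) (g + h)
      = (\<Sum>x\<in>Poly_Mapping.keys p. Poly_Mapping.lookup p x * Poly_Mapping.lookup q (- x + (g + h)))"
    by (rule lookup_mult_group) auto
  also have "\<dots> = Poly_Mapping.lookup p g * Poly_Mapping.lookup q (- g + (g + h))"
    using assms(1) by (subst sum.remove[of _ g]) (simp_all only: finite_keys sum.neutral[OF ballI[OF zero]] add_0_right)
  also have "\<dots> \<noteq> 0" using assms by (simp add: in_keys_iff flip: add.assoc)
  finally show ?thesis by (simp add: in_keys_iff)
qed

text \<open>The signs \<open>\<delta>, \<epsilon> \<in> {1, -1}\<close> select one of the four corners of the support.\<close>

definition corner :: "int \<Rightarrow> int \<Rightarrow> int \<Rightarrow> int \<Rightarrow> (klein \<Rightarrow>\<^sub>0 int) \<Rightarrow> bool" where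
  "corner \<delta> \<epsilon> a m p \<longleftrightarrow> Klein a m \<in> Poly_Mapping.keys p \<and>
     (\<forall>b n. Klein b n \<in> Poly_Mapping.keys p \<longrightarrow> \<delta> * n \<le> \<delta> * m \<and> (n = m \<longrightarrow> \<epsilon> * b \<le> \<epsilon> * a))"

lemma corner_exists:
  assumes "p \<noteq> 0"
  obtains a m where "corner \<delta> \<epsilon> a m p"
proof -
  let ?K = "Poly_Mapping.keys p"
  have K: "finite ?K" "?K \<noteq> {}" using assms by simp_all
  have "Max ((\<lambda>g. \<delta> * ypart g) ` ?K) \<in> (\<lambda>g. \<delta> * ypart g) ` ?K" using K by (intro Max_in) auto
  then obtain h where h: "h \<in> ?K" "\<delta> * ypart h = Max ((\<lambda>g. \<delta> * ypart g) ` ?K)" by auto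
  let ?L = "{g\<in>?K. ypart g = ypart h}"
  have "Max ((\<lambda>g. \<epsilon> * xpart g) ` ?L) \<in> (\<lambda>g. \<epsilon> * xpart g) ` ?L" using K h by (intro Max_in) auto
  then obtain k where k: "k \<in> ?L" "\<epsilon> * xpart k = Max ((\<lambda>g. \<epsilon> * xpart g) ` ?L)" by auto
  have "\<delta> * n \<le> \<delta> * ypart h" if "Klein b n \<in> ?K" for b n
    unfolding h(2) using K that by (intro Max_ge) (auto intro: rev_image_eqI)
  moreover have "\<epsilon> * b \<le> \<epsilon> * xpart k" if "Klein b (ypart h) \<in> ?K" for b
    unfolding k(2) using K that by (intro Max_ge) (auto intro: rev_image_eqI)
  ultimately have "corner \<delta> \<epsilon> (xpart k) (ypart h) p"
    using k(1) by (auto simp: corner_def) (metis klein.collapse)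
  then show ?thesis by (rule that)
qed

text \<open>Corners multiply. Moving the \<open>m\<close>-th power of \<open>y\<close> past a power
  of \<open>x\<close> multiplies the exponent of \<open>x\<close> by \<open>flip m\<close>, so the
  corner of \<open>q\<close> is taken in the direction \<open>\<epsilon> * flip m\<close>.\<close>

lemma corner_mult:
  assumes \<delta>: "\<delta> = 1 \<or> \<delta> = - 1" and \<epsilon>: "\<epsilon> = 1 \<or> \<epsilon> = - 1"
    and p: "corner \<delta> \<epsilon> a m p" and q: "corner \<delta> (\<epsilon> * flip m) b n q"
  shows "Klein (a + flip m * b) (m + n) \<in> Poly_Mapping.keys (p * q)"
proof -
  have "Klein a m + Klein b n \<in> Poly_Mapping.keys (p * q)"
  proof (rule in_keys_mult)
    fix g h assume *: "g \<in> Poly_Mapping.keys p" "h \<in> Poly_Mapping.keys q" "g + h = Klein a m + Klein b n"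
    obtain a' m' b' n' where gh: "g = Klein a' m'" "h = Klein b' n'" by (cases g, cases h) auto
    have "\<delta> * m' \<le> \<delta> * m" "\<delta> * n' \<le> \<delta> * n" "m' + n' = m + n"
      using * p q by (auto simp: corner_def gh)
    then have mn: "m' = m" "n' = n" using \<delta> by auto
    then have "\<epsilon> * a' \<le> \<epsilon> * a" "\<epsilon> * flip m * b' \<le> \<epsilon> * flip m * b" "a' + flip m * b' = a + flip m * b"
      using * p q by (auto simp: corner_def gh)
    then have "a' = a" using \<epsilon> by (auto simp: flip_def split: if_splits)
    then show "g = Klein a m" by (simp add: gh mn)
  qed (use p q in \<open>auto simp: corner_def\<close>)
  then show ?thesis by simp
qed

lemma klein_ring_no_zero_divisors:
  fixes p q :: "klein \<Rightarrow>\<^sub>0 int"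
  assumes "p * q = 0"
  shows "p = 0 \<or> q = 0"
proof (rule ccontr)
  assume "\<not> (p = 0 \<or> q = 0)"
  then obtain a m b n where "corner 1 1 a m p" "corner 1 (1 * flip m) b n q"
    by (metis corner_exists)
  from corner_mult[OF _ _ this] assms show False by simp
qed

text \<open>The highest and the lowest exponents of \<open>y\<close> are both additive under
  multiplication. If they coincide in the product, they coincide in the factors.\<close>

lemma homogeneous_factor:
  fixes p q :: "klein \<Rightarrow>\<^sub>0 int"
  assumes "p * q \<noteq> 0" "\<And>g. g \<in> Poly_Mapping.keys (p * q) \<Longrightarrow> ypart g = 0"
  obtains m where "\<And>g. g \<in> Poly_Mapping.keys q \<Longrightarrow> ypart g = m"
proof -
  have "p \<noteq> 0" "q \<noteq> 0" using assms by auto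
  then obtain a m b n where 1: "corner 1 1 a m p" "corner 1 (1 * flip m) b n q" by (metis corner_exists)
  from \<open>p \<noteq> 0\<close> \<open>q \<noteq> 0\<close> obtain a' m' b' n' where
    2: "corner (- 1) 1 a' m' p" "corner (- 1) (1 * flip m') b' n' q" by (metis corner_exists)
  have "m + n = 0" using assms(2)[OF corner_mult[OF _ _ 1]] by simp
  moreover have "m' + n' = 0" using assms(2)[OF corner_mult[OF _ _ 2]] by simp
  moreover have "m' \<le> m" using 1(1) 2(1) by (auto simp: corner_def)
  ultimately have "n \<le> n'" by simp
  have "ypart g = n" if "g \<in> Poly_Mapping.keys q" for g
  proof -
    have "ypart g \<le> n" "n' \<le> ypart g" using 1(2) 2(2) that by (cases g; force simp: corner_def)+
    with \<open>n \<le> n'\<close> show ?thesis by simp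
  qed
  then show ?thesis by (rule that)
qed

section \<open>Homogeneous components and the elements \<open>rho\<close> and
  \<open>eta\<close>\<close>

abbreviation mon :: "int \<Rightarrow> int \<Rightarrow> klein \<Rightarrow>\<^sub>0 int" where
  "mon a m \<equiv> Poly_Mapping.single (Klein a m) 1"

lemma mon_0: "mon 0 0 = 1"
  by (metis single_one zero_klein_def)

text \<open>The group ring is graded by the exponent of \<open>y\<close>; \<open>rho\<close> and
  \<open>rho'\<close> have degree 0, so equations between their multiples split into
  degrees.\<close>

definition slice :: "int \<Rightarrow> (klein \<Rightarrow>\<^sub>0 int) \<Rightarrow> klein \<Rightarrow>\<^sub>0 int" where
  "slice m = restr (\<lambda>g. ypart g = m)"

lemma slice_simps:
  "slice m (p + q) = slice m p + slice m q" "slice m (p - q) = slice m p - slice m q"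
  "slice m (- p) = - slice m p" "slice m (0) = 0"
  "slice m (mon a n * p) = mon a n * slice (m - n) p"
  "slice m (of_int k * p) = of_int k * slice m p"
proof -
  show "slice m (mon a n * p) = mon a n * slice (m - n) p"
    by (rule poly_mapping_eqI) (auto simp: slice_def lookup_single_mult_group plus_klein_def)
  show "slice m (of_int k * p) = of_int k * slice m p"
    by (rule poly_mapping_eqI) (simp add: slice_def lookup_single_mult_group flip: single_0_int)
qed (rule poly_mapping_eqI; simp add: slice_def lookup_add lookup_minus)+

definition rho :: "klein \<Rightarrow>\<^sub>0 int" where "rho = mon 3 0 - mon 1 0 - 1"
definition rho' :: "klein \<Rightarrow>\<^sub>0 int" where "rho' = mon (- 3) 0 - mon (- 1) 0 - 1"
text \<open>\<open>alpha\<close> and \<open>beta\<close> are Bezout coefficients that make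
  \<open>rho\<close> and its conjugate \<open>rho'\<close> comaximal.\<close>

definition alpha :: "klein \<Rightarrow>\<^sub>0 int" where "alpha = - mon 1 0"
definition beta :: "klein \<Rightarrow>\<^sub>0 int" where "beta = mon 3 0 - mon 4 0"
definition eta :: "klein \<Rightarrow>\<^sub>0 int" where "eta = 1 + mon 0 1"

lemma slice_rho_mult: "slice m (rho * p) = rho * slice m p" "slice m (rho' * p) = rho' * slice m p"
  by (simp_all add: rho_def rho'_def left_diff_distrib slice_simps)

lemma bezout: "alpha * rho + beta * rho' = 1"
  by (simp add: alpha_def beta_def rho_def rho'_def algebra_simps mult_single mon_0 single_uminus)

lemma rho_commute: "rho' * rho = rho * rho'"
  by (simp add: rho_def rho'_def algebra_simps mult_single)

lemma flip_rho: "mon 0 1 * rho = rho' * mon 0 1" "mon 0 1 * rho' = rho * mon 0 1"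
    "mon 0 (- 1) * rho = rho' * mon 0 (- 1)"
  by (simp_all add: rho_def rho'_def algebra_simps mult_single flip_def)

text \<open>The product \<open>rho * rho'\<close> is a Laurent polynomial invariant under inverting
  \<open>x\<close>, hence an integral combination of 1 and elements \<open>x^a + x^-a\<close>.
  Conjugation by \<open>y\<close> exchanges the two summands, so each of these is central.\<close>

lemma norm_central: "rho * rho' * p = p * (rho * rho')"
proof -
  have N: "rho * rho' = 3 + (mon 1 0 + mon (- 1) 0) - (mon 2 0 + mon (- 2) 0) - (mon 3 0 + mon (- 3) 0)"
    by (simp add: rho_def rho'_def algebra_simps mult_single mon_0)
  have *: "(mon a 0 + mon (- a) 0) * p = p * (mon a 0 + mon (- a) 0)" for a and p :: "klein \<Rightarrow>\<^sub>0 int"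
  proof -
    have "(mon a 0 + mon (- a) 0) * Poly_Mapping.single g k = Poly_Mapping.single g k * (mon a 0 + mon (- a) 0)"
      for g k
      by (cases g) (auto simp: algebra_simps mult_single flip_def)
    then have "(mon a 0 + mon (- a) 0) * (\<Sum>g\<in>Poly_Mapping.keys p. Poly_Mapping.single g (Poly_Mapping.lookup p g))
      = (\<Sum>g\<in>Poly_Mapping.keys p. Poly_Mapping.single g (Poly_Mapping.lookup p g)) * (mon a 0 + mon (- a) 0)"
      by (simp only: sum_distrib_left sum_distrib_right)
    then show ?thesis by (simp flip: lookup_sum_keys)
  qed
  show ?thesis
    unfolding N left_diff_distrib right_diff_distrib distrib_right[of 3] distrib_left[of _ 3] *
    by (metis mult_of_int_commute of_int_numeral)
qed

lemma rho_nonzero: "rho \<noteq> 0" "rho * rho' \<noteq> 0"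
proof -
  have "Poly_Mapping.lookup rho 0 = - 1" "Poly_Mapping.lookup rho' 0 = - 1"
    by (simp_all add: rho_def rho'_def lookup_minus lookup_single lookup_one)
  then show "rho \<noteq> 0" "rho * rho' \<noteq> 0" using klein_ring_no_zero_divisors[of rho rho'] by auto
qed

section \<open>Functionals on the solutions of \<open>rho * v + eta * w = 0\<close>\<close>

lemma kernel_functional:
  assumes "rho * v + eta * w = 0"
  shows "(q * (rho * rho') - p * rho' * eta) * w = rho * rho' * (p * v + q * w)"
proof -
  have "eta * w = - (rho * v)" using assms by (simp add: eq_neg_iff_add_eq_0 add.commute)
  \<comment> \<open>Multiplication by \<open>rho'\<close> turns \<open>rho\<close> into the central
    element \<open>rho * rho'\<close>, which eliminates \<open>v\<close> without division by
    \<open>rho\<close>.\<close>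
  then have "p * rho' * eta * w = - (p * (rho' * rho) * v)" by (simp add: mult.assoc)
  also have "p * (rho' * rho) = rho * rho' * p" by (simp add: rho_commute norm_central)
  finally show ?thesis by (simp add: norm_central[of q, symmetric] algebra_simps)
qed

lemma rank_one_kernel_rho_eta: "rank_one_kernel rho eta"
  unfolding rank_one_kernel_def
proof (intro allI impI)
  fix p1 p2 v w v' w'
  assume vw: "rho * v + eta * w = 0" and vw': "rho * v' + eta * w' = 0"
    and p: "p1 * v + p2 * w = 0" and nz: "v \<noteq> 0 \<or> w \<noteq> 0"
  \<comment> \<open>Since \<open>rho\<close> is not a zero divisor, \<open>w\<close> determines
    \<open>v\<close>. A functional can then kill a nonzero solution only if its factor in front of
    \<open>w\<close> is zero.\<close>
  have "w \<noteq> 0" using nz vw klein_ring_no_zero_divisors[of rho v] rho_nonzero by auto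
  then have "p2 * (rho * rho') - p1 * rho' * eta = 0"
    using kernel_functional[OF vw, of p2 p1] p klein_ring_no_zero_divisors by fastforce
  then have "rho * rho' * (p1 * v' + p2 * w') = 0"
    using kernel_functional[OF vw', of p2 p1] by simp
  then show "p1 * v' + p2 * w' = 0"
    using klein_ring_no_zero_divisors rho_nonzero by blast
qed

text \<open>Along the highest power of \<open>y\<close>, the exponents of \<open>x\<close> in
  \<open>rho'\<close> have width 3, and widths add under multiplication; a nonzero integer has width
  0.\<close>

lemma no_unit_multiple_rho':
  assumes "rho' * t = of_int n"
  shows "n = 0"
proof (rule ccontr)
  assume n: "n \<noteq> 0"
  then have "t \<noteq> 0" using assms by auto
  then obtain b k b' k' where t: "corner 1 1 b k t" "corner 1 (- 1) b' k' t" by (metis corner_exists)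
  have lookup: "Poly_Mapping.lookup rho' (Klein a m) =
      (if m = 0 then (if a = - 3 then 1 else if a = - 1 \<or> a = 0 then - 1 else 0) else 0)" for a m
    by (auto simp: rho'_def lookup_minus lookup_single lookup_one when_def)
  have "corner 1 1 0 0 rho'" "corner 1 (- 1) (- 3) 0 rho'"
    by (auto simp: corner_def in_keys_iff lookup split: if_splits)
  from corner_mult[OF _ _ this(1), of b k t] corner_mult[OF _ _ this(2), of b' k' t]
  have "Klein b k \<in> Poly_Mapping.keys (of_int n :: klein \<Rightarrow>\<^sub>0 int)"
    "Klein (- 3 + b') k' \<in> Poly_Mapping.keys (of_int n :: klein \<Rightarrow>\<^sub>0 int)"
    using t assms by simp_all
  then have "b = 0" "k = 0" "b' = 3" "k' = 0"
    by (auto simp: in_keys_iff lookup_of_int when_def split: if_splits)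
  then show False using t by (force simp: corner_def)
qed

text \<open>A nonzero value \<open>n\<close> forces \<open>w = ?N * z\<close> with \<open>z\<close>
  invertible up to \<open>n\<close>. Then \<open>n\<close> times the second entry of every solution
  is divisible by \<open>?N\<close>, which an explicit solution refutes.\<close>

lemma no_scalar_values_rho_eta: "no_scalar_values rho eta"
  unfolding no_scalar_values_def
proof (intro allI impI, rule ccontr)
  fix p1 p2 v w n
  assume vw: "rho * v + eta * w = 0" and p: "p1 * v + p2 * w = of_int n" and n: "n \<noteq> 0"
  let ?N = "rho * rho'"
  define q where "q = p2 * ?N - p1 * rho' * eta"
  have qw: "q * w = ?N * of_int n"
    using kernel_functional[OF vw] p by (simp add: q_def)
  have sl_N: "slice m (?N * t) = ?N * slice m t" for m t
    by (simp add: mult.assoc slice_rho_mult)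
  have sl_1: "slice m 1 = (if m = 0 then 1 else 0)" for m
    by (rule poly_mapping_eqI) (auto simp: slice_def lookup_one when_def zero_klein_def)
  have of_int_cancel: "t = 0" if "of_int n * t = 0" for t :: "klein \<Rightarrow>\<^sub>0 int"
    using klein_ring_no_zero_divisors[OF that] n by auto
  have nz: "?N * of_int n \<noteq> 0" using klein_ring_no_zero_divisors rho_nonzero n by (metis of_int_eq_0_iff)
  \<comment> \<open>The product \<open>q * w\<close> is nonzero of degree 0 in \<open>y\<close>, so
    \<open>w\<close> is homogeneous.\<close>
  have "slice 0 (q * w) = q * w"
    unfolding qw using sl_N[of 0 "of_int n"] slice_simps(6)[of 0 n 1] sl_1 by simp
  then have "ypart g = 0" if "g \<in> Poly_Mapping.keys (q * w)" for g
    using that by (metis (mono_tags) in_keys_iff lookup_restr slice_def)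
  then obtain m where m: "\<And>g. g \<in> Poly_Mapping.keys w \<Longrightarrow> ypart g = m"
    using homogeneous_factor[of q w] nz qw by metis
  have slice_w: "slice k w = (if k = m then w else 0)" for k
    using m by (intro poly_mapping_eqI) (auto simp: slice_def in_keys_iff)
  \<comment> \<open>As \<open>eta\<close> has terms of degrees 0 and 1, the equation gives
    conditions on \<open>w\<close> in the degrees \<open>m\<close> and \<open>m + 1\<close>: it lies
    in the right ideal of \<open>rho\<close> and, after conjugation by \<open>y\<close>, in that of
    \<open>rho'\<close>.\<close>
  have "slice k (rho * v + (w + mon 0 1 * w)) = 0" for k
    using vw by (simp add: eta_def distrib_right slice_simps)
  then have e: "rho * slice k v + (slice k w + mon 0 1 * slice (k - 1) w) = 0" for k
    by (simp only: slice_simps slice_rho_mult)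
  have w1: "w = - (rho * slice m v)" and w2: "mon 0 1 * w = - (rho * slice (m + 1) v)"
    using e[of m] e[of "m + 1"] by (simp_all add: slice_w eq_neg_iff_add_eq_0 add.commute)
  define v' where "v' = mon 0 (- 1) * slice (m + 1) v"
  have "w = mon 0 (- 1) * (mon 0 1 * w)"
    by (simp add: mult_single mon_0 flip: mult.assoc)
  then have w3: "w = - (rho' * v')"
    by (simp add: w2 v'_def flip_rho flip: mult.assoc)
  \<comment> \<open>Divisibility by both comaximal elements gives divisibility by their central
    product; the quotient is read off from the Bezout identity.\<close>
  define z where "z = - (alpha * v' + beta * slice m v)"
  have "w = alpha * (rho * w) + beta * (rho' * w)"
    by (simp add: bezout flip: mult.assoc distrib_right)
  also have "rho * w = - (rho * (rho' * v'))" by (subst w3) simp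
  also have "rho' * w = - (rho' * (rho * slice m v))" by (subst w1) simp
  also have "alpha * - (rho * (rho' * v')) = - (?N * (alpha * v'))"
  proof -
    have "alpha * (rho * (rho' * v')) = alpha * ?N * v'" by (simp only: mult.assoc)
    then show ?thesis by (simp only: norm_central[symmetric] mult.assoc mult_minus_right)
  qed
  also have "beta * - (rho' * (rho * slice m v)) = - (?N * (beta * slice m v))"
  proof -
    have "beta * (rho' * (rho * slice m v)) = beta * ?N * slice m v"
      by (simp only: mult.assoc[symmetric] rho_commute)
    then show ?thesis by (simp only: norm_central[symmetric] mult.assoc mult_minus_right)
  qed
  also have "- (?N * (alpha * v')) + - (?N * (beta * slice m v)) = ?N * z"
    by (simp only: z_def distrib_left mult_minus_right minus_add_distrib)
  finally have w: "w = ?N * z" .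
  have "?N * (q * z - of_int n) = 0"
    using qw norm_central[of q] by (simp add: w right_diff_distrib flip: mult.assoc)
  then have qz: "q * z = of_int n"
    using klein_ring_no_zero_divisors rho_nonzero by fastforce
  \<comment> \<open>In a domain, an inverse up to the central \<open>n\<close> on one side is one on
    the other side as well.\<close>
  have "(z * q - of_int n) * z = 0"
    by (simp add: left_diff_distrib mult.assoc qz) (simp add: mult_of_int_commute)
  moreover have "z \<noteq> 0" using qz n by auto
  ultimately have zq: "z * q = of_int n"
    using klein_ring_no_zero_divisors by fastforce
  \<comment> \<open>A test solution, available because the square of \<open>y\<close> commutes with
    \<open>x\<close>; the second entry has \<open>rho\<close> in degree 0.\<close>
  define v1 where "v1 = mon 0 2 - 1"
  define w1 where "w1 = rho - mon 0 1 * rho"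
  have "mon 0 2 * rho = rho * mon 0 2"
    by (simp add: rho_def algebra_simps mult_single flip_def)
  then have "rho * v1 + eta * w1 = 0"
    by (simp add: v1_def w1_def eta_def left_diff_distrib right_diff_distrib distrib_right
        distrib_left mult_single flip: mult.assoc)
  then have "q * w1 = ?N * (p1 * v1 + p2 * w1)"
    unfolding q_def by (rule kernel_functional)
  then have "z * (q * w1) = ?N * (z * (p1 * v1 + p2 * w1))"
    using norm_central[of z] by (simp flip: mult.assoc)
  then have "of_int n * w1 = ?N * (z * (p1 * v1 + p2 * w1))"
    by (simp add: zq flip: mult.assoc)
  moreover have "slice k rho = (if k = 0 then rho else 0)" for k
    using slice_rho_mult(1)[of k 1] sl_1 by simp
  then have "slice 0 (of_int n * w1) = of_int n * rho"
    by (simp add: w1_def slice_simps)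
  ultimately have "?N * slice 0 (z * (p1 * v1 + p2 * w1)) = of_int n * rho"
    by (simp add: sl_N)
  \<comment> \<open>Cancelling \<open>rho\<close> in degree 0 leaves \<open>rho'\<close> as a
    divisor of \<open>n\<close>.\<close>
  then have "rho * (rho' * slice 0 (z * (p1 * v1 + p2 * w1)) - of_int n) = 0"
    by (simp add: right_diff_distrib mult_of_int_commute flip: mult.assoc)
  then have "rho' * slice 0 (z * (p1 * v1 + p2 * w1)) = of_int n"
    using klein_ring_no_zero_divisors rho_nonzero by fastforce
  then show False using no_unit_multiple_rho' n by blast
qed

text \<open>As \<open>rho * y = y * rho'\<close>, the term \<open>- y * beta\<close> cancels what
  the summand \<open>y\<close> of \<open>eta\<close> contributes, and the Bezout identity
  remains.\<close>

lemma unimodular_rho_eta: "rho * (alpha - mon 0 1 * beta) + eta * (beta * rho') = 1"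
proof -
  have comm: "beta * rho' = rho' * beta" "alpha * rho = rho * alpha"
    by (simp_all add: alpha_def beta_def rho_def rho'_def algebra_simps mult_single)
  have "rho * (mon 0 1 * beta) = mon 0 1 * (beta * rho')"
    by (simp add: comm flip_rho flip: mult.assoc)
  then have "rho * (alpha - mon 0 1 * beta) + eta * (beta * rho') = alpha * rho + beta * rho'"
    by (simp add: comm(2) eta_def right_diff_distrib distrib_right)
  then show ?thesis using bezout by simp
qed

section \<open>Modules cut out by unimodular columns\<close>

context left_module
begin

lemma smult_l_null: "x \<in> carrier M \<Longrightarrow> \<zero>\<^bsub>R\<^esub> \<odot>\<^bsub>M\<^esub> x = \<zero>\<^bsub>M\<^esub>"
  using smult_l_distr[of "\<zero>\<^bsub>R\<^esub>" "\<zero>\<^bsub>R\<^esub>" x] smult_closed[of "\<zero>\<^bsub>R\<^esub>" x]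
  by simp

lemma smult_r_null: "a \<in> carrier R \<Longrightarrow> a \<odot>\<^bsub>M\<^esub> \<zero>\<^bsub>M\<^esub> = \<zero>\<^bsub>M\<^esub>"
  using smult_r_distr[of a "\<zero>\<^bsub>M\<^esub>" "\<zero>\<^bsub>M\<^esub>"] smult_closed[of a "\<zero>\<^bsub>M\<^esub>"]
  by simp

lemma finsum_smult:
  assumes "a \<in> carrier R" "finite A" "f \<in> A \<rightarrow> carrier M"
  shows "a \<odot>\<^bsub>M\<^esub> (\<Oplus>\<^bsub>M\<^esub>x\<in>A. f x) = (\<Oplus>\<^bsub>M\<^esub>x\<in>A. a \<odot>\<^bsub>M\<^esub> f x)"
  using assms(2,3)
proof (induction A rule: finite_induct)
  case (insert x A)
  then have "f x \<in> carrier M" "f \<in> A \<rightarrow> carrier M" by auto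
  moreover have "(\<lambda>y. a \<odot>\<^bsub>M\<^esub> f y) \<in> A \<rightarrow> carrier M"
    using insert.prems assms(1) by (auto intro: smult_closed)
  ultimately show ?case
    using insert assms(1) by (simp add: M.finsum_insert M.finsum_closed smult_closed smult_r_distr)
qed (simp add: M.finsum_empty smult_r_null assms(1))

text \<open>Finite generation speaks of a set of generators, whereas they arise as an indexed family
  that may have repetitions; the coefficients of equal generators are added up.\<close>

lemma finsum_regroup:
  assumes "finite I" "g \<in> I \<rightarrow> carrier M" "r \<in> I \<rightarrow> carrier R"
  shows "\<exists>c\<in>g ` I \<rightarrow> carrier R. (\<Oplus>\<^bsub>M\<^esub>n\<in>I. r n \<odot>\<^bsub>M\<^esub> g n) = (\<Oplus>\<^bsub>M\<^esub>a\<in>g ` I. c a \<odot>\<^bsub>M\<^esub> a)"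
  using assms
proof (induction I rule: finite_induct)
  case (insert m I)
  have "g \<in> I \<rightarrow> carrier M" "r \<in> I \<rightarrow> carrier R" using insert.prems by auto
  then obtain c where c: "c \<in> g ` I \<rightarrow> carrier R"
    "(\<Oplus>\<^bsub>M\<^esub>n\<in>I. r n \<odot>\<^bsub>M\<^esub> g n) = (\<Oplus>\<^bsub>M\<^esub>a\<in>g ` I. c a \<odot>\<^bsub>M\<^esub> a)"
    using insert.IH by blast
  have car: "g ` I \<subseteq> carrier M" "g m \<in> carrier M" "r m \<in> carrier R"
    "(\<lambda>n. r n \<odot>\<^bsub>M\<^esub> g n) \<in> I \<rightarrow> carrier M"
    using insert.prems by (auto intro!: smult_closed)
  let ?A = "g ` I - {g m}"
  have fin: "finite ?A" using insert.hyps by simp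
  have cA: "(\<lambda>a. c a \<odot>\<^bsub>M\<^esub> a) \<in> ?A \<rightarrow> carrier M"
    using c(1) car(1) by (auto intro!: smult_closed)
  define c0 where "c0 = (if g m \<in> g ` I then c (g m) else \<zero>\<^bsub>R\<^esub>)"
  have c0: "c0 \<in> carrier R" using c(1) by (auto simp: c0_def)
  have "(\<Oplus>\<^bsub>M\<^esub>a\<in>g ` I. c a \<odot>\<^bsub>M\<^esub> a) = c0 \<odot>\<^bsub>M\<^esub> g m \<oplus>\<^bsub>M\<^esub> (\<Oplus>\<^bsub>M\<^esub>a\<in>?A. c a \<odot>\<^bsub>M\<^esub> a)"
  proof (cases "g m \<in> g ` I")
    case True
    then have "insert (g m) ?A = g ` I" by blast
    then show ?thesis
      using M.finsum_insert[OF fin _ cA, of "g m"] True c0 car by (simp add: c0_def smult_closed)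
  next
    case False
    then show ?thesis using cA car by (simp add: c0_def smult_l_null M.finsum_closed)
  qed
  then have "(\<Oplus>\<^bsub>M\<^esub>n\<in>insert m I. r n \<odot>\<^bsub>M\<^esub> g n)
      = r m \<odot>\<^bsub>M\<^esub> g m \<oplus>\<^bsub>M\<^esub> (c0 \<odot>\<^bsub>M\<^esub> g m \<oplus>\<^bsub>M\<^esub> (\<Oplus>\<^bsub>M\<^esub>a\<in>?A. c a \<odot>\<^bsub>M\<^esub> a))"
    using insert.hyps car c(2) by (simp add: M.finsum_insert smult_closed)
  also have "\<dots> = (r m \<oplus>\<^bsub>R\<^esub> c0) \<odot>\<^bsub>M\<^esub> g m \<oplus>\<^bsub>M\<^esub> (\<Oplus>\<^bsub>M\<^esub>a\<in>?A. c a \<odot>\<^bsub>M\<^esub> a)"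
    using c0 car cA by (simp add: smult_l_distr M.a_assoc smult_closed M.finsum_closed)
  also have "(\<Oplus>\<^bsub>M\<^esub>a\<in>?A. c a \<odot>\<^bsub>M\<^esub> a) = (\<Oplus>\<^bsub>M\<^esub>a\<in>?A. (c(g m := r m \<oplus>\<^bsub>R\<^esub> c0)) a \<odot>\<^bsub>M\<^esub> a)"
    using c(1) car(1) c0 by (intro M.finsum_cong') (auto intro!: smult_closed)
  also have "(r m \<oplus>\<^bsub>R\<^esub> c0) \<odot>\<^bsub>M\<^esub> g m \<oplus>\<^bsub>M\<^esub> \<dots>
      = (\<Oplus>\<^bsub>M\<^esub>a\<in>insert (g m) ?A. (c(g m := r m \<oplus>\<^bsub>R\<^esub> c0)) a \<odot>\<^bsub>M\<^esub> a)"
    using fin cA c0 car by (subst M.finsum_insert) (auto simp: smult_closed Pi_iff)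
  also have "insert (g m) ?A = g ` insert m I" by blast
  finally show ?case
    using c(1) c0 car(3) by (intro bexI[of _ "c(g m := r m \<oplus>\<^bsub>R\<^esub> c0)"]) auto
qed simp

text \<open>The coefficient at \<open>b\<close> is linear because coefficients are unique: sums and
  multiples of coefficient families represent the sums and multiples of the elements.\<close>

lemma basis_coordinate:
  assumes basis: "module_basis R M B" and b: "b \<in> B" and nontrivial: "\<one>\<^bsub>R\<^esub> \<noteq> \<zero>\<^bsub>R\<^esub>"
  shows "\<exists>\<phi>\<in>carrier M \<rightarrow> carrier R. \<phi> b = \<one>\<^bsub>R\<^esub> \<and>
           (\<forall>x\<in>carrier M. \<forall>y\<in>carrier M. \<phi> (x \<oplus>\<^bsub>M\<^esub> y) = \<phi> x \<oplus>\<^bsub>R\<^esub> \<phi> y) \<and>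
           (\<forall>a\<in>carrier R. \<forall>x\<in>carrier M. \<phi> (a \<odot>\<^bsub>M\<^esub> x) = a \<otimes>\<^bsub>R\<^esub> \<phi> x)"
proof -
  define repr where "repr x c \<longleftrightarrow> c \<in> UNIV \<rightarrow> carrier R \<and> finite {b. c b \<noteq> \<zero>\<^bsub>R\<^esub>} \<and>
      {b. c b \<noteq> \<zero>\<^bsub>R\<^esub>} \<subseteq> B \<and> x = (\<Oplus>\<^bsub>M\<^esub>b\<in>{b. c b \<noteq> \<zero>\<^bsub>R\<^esub>}. c b \<odot>\<^bsub>M\<^esub> b)" for x c
  have B: "B \<subseteq> carrier M" and ex1: "x \<in> carrier M \<Longrightarrow> \<exists>!c. repr x c" for x
    using basis by (auto simp: module_basis_def repr_def)
  \<comment> \<open>Supports of different families differ; sums over them become comparable on a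
    common finite set.\<close>
  have sum_superset: "(\<Oplus>\<^bsub>M\<^esub>b\<in>{b. c b \<noteq> \<zero>\<^bsub>R\<^esub>}. c b \<odot>\<^bsub>M\<^esub> b) = (\<Oplus>\<^bsub>M\<^esub>b\<in>F. c b \<odot>\<^bsub>M\<^esub> b)"
    if "c \<in> UNIV \<rightarrow> carrier R" "finite F" "{b. c b \<noteq> \<zero>\<^bsub>R\<^esub>} \<subseteq> F" "F \<subseteq> B" for c F
    using that B by (intro M.add.finprod_mono_neutral_cong_left) (auto simp: smult_l_null intro!: smult_closed)
  have reprI: "repr (\<Oplus>\<^bsub>M\<^esub>b\<in>F. c b \<odot>\<^bsub>M\<^esub> b) c"
    if "c \<in> UNIV \<rightarrow> carrier R" "finite F" "{b. c b \<noteq> \<zero>\<^bsub>R\<^esub>} \<subseteq> F" "F \<subseteq> B" for c F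
    using that sum_superset[OF that] finite_subset[OF that(3,2)] by (auto simp: repr_def)
  define coeff where "coeff x = (THE c. repr x c)" for x
  have coeff: "repr x (coeff x)" if "x \<in> carrier M" for x
    unfolding coeff_def by (rule theI'[OF ex1[OF that]])
  have coeff_eqI: "coeff x = c" if "repr x c" "x \<in> carrier M" for x c
    using ex1[OF that(2)] coeff[OF that(2)] that(1) by auto
  have coeff_closed: "coeff x c \<in> carrier R" if "x \<in> carrier M" for x c
    using coeff[OF that] by (auto simp: repr_def)
  have add: "coeff (x \<oplus>\<^bsub>M\<^esub> y) b = coeff x b \<oplus>\<^bsub>R\<^esub> coeff y b"
    if x: "x \<in> carrier M" and y: "y \<in> carrier M" for x y
  proof -
    let ?F = "{b. coeff x b \<noteq> \<zero>\<^bsub>R\<^esub>} \<union> {b. coeff y b \<noteq> \<zero>\<^bsub>R\<^esub>}"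
    let ?c = "\<lambda>b. coeff x b \<oplus>\<^bsub>R\<^esub> coeff y b"
    have F: "finite ?F" "?F \<subseteq> B" using coeff[OF x] coeff[OF y] by (auto simp: repr_def)
    have "x = (\<Oplus>\<^bsub>M\<^esub>b\<in>?F. coeff x b \<odot>\<^bsub>M\<^esub> b)" "y = (\<Oplus>\<^bsub>M\<^esub>b\<in>?F. coeff y b \<odot>\<^bsub>M\<^esub> b)"
      using coeff[OF x] coeff[OF y] F sum_superset[of "coeff x" ?F] sum_superset[of "coeff y" ?F]
      by (auto simp: repr_def)
    then have "x \<oplus>\<^bsub>M\<^esub> y = (\<Oplus>\<^bsub>M\<^esub>b\<in>?F. coeff x b \<odot>\<^bsub>M\<^esub> b) \<oplus>\<^bsub>M\<^esub> (\<Oplus>\<^bsub>M\<^esub>b\<in>?F. coeff y b \<odot>\<^bsub>M\<^esub> b)"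
      by simp
    also have "\<dots> = (\<Oplus>\<^bsub>M\<^esub>b\<in>?F. coeff x b \<odot>\<^bsub>M\<^esub> b \<oplus>\<^bsub>M\<^esub> coeff y b \<odot>\<^bsub>M\<^esub> b)"
      using F B coeff_closed[OF x] coeff_closed[OF y]
      by (intro M.finsum_addf[symmetric]) (auto intro!: smult_closed)
    also have "\<dots> = (\<Oplus>\<^bsub>M\<^esub>b\<in>?F. ?c b \<odot>\<^bsub>M\<^esub> b)"
      using F B coeff_closed[OF x] coeff_closed[OF y]
      by (intro M.finsum_cong') (auto simp: smult_l_distr intro!: smult_closed)
    finally have sum: "x \<oplus>\<^bsub>M\<^esub> y = (\<Oplus>\<^bsub>M\<^esub>b\<in>?F. ?c b \<odot>\<^bsub>M\<^esub> b)" .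
    have "{b. ?c b \<noteq> \<zero>\<^bsub>R\<^esub>} \<subseteq> ?F" by auto
    then have "repr (x \<oplus>\<^bsub>M\<^esub> y) ?c"
      unfolding sum using F coeff_closed[OF x] coeff_closed[OF y] by (intro reprI) auto
    then show ?thesis using coeff_eqI x y by auto
  qed
  have smult: "coeff (a \<odot>\<^bsub>M\<^esub> x) b = a \<otimes>\<^bsub>R\<^esub> coeff x b"
    if a: "a \<in> carrier R" and x: "x \<in> carrier M" for a x
  proof -
    let ?F = "{b. coeff x b \<noteq> \<zero>\<^bsub>R\<^esub>}"
    let ?c = "\<lambda>b. a \<otimes>\<^bsub>R\<^esub> coeff x b"
    have F: "finite ?F" "?F \<subseteq> B" and xF: "x = (\<Oplus>\<^bsub>M\<^esub>b\<in>?F. coeff x b \<odot>\<^bsub>M\<^esub> b)"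
      using coeff[OF x] by (auto simp: repr_def)
    have "a \<odot>\<^bsub>M\<^esub> x = a \<odot>\<^bsub>M\<^esub> (\<Oplus>\<^bsub>M\<^esub>b\<in>?F. coeff x b \<odot>\<^bsub>M\<^esub> b)"
      using xF by simp
    also have "\<dots> = (\<Oplus>\<^bsub>M\<^esub>b\<in>?F. a \<odot>\<^bsub>M\<^esub> (coeff x b \<odot>\<^bsub>M\<^esub> b))"
      using F B coeff_closed[OF x] a by (intro finsum_smult) (auto intro!: smult_closed)
    also have "\<dots> = (\<Oplus>\<^bsub>M\<^esub>b\<in>?F. ?c b \<odot>\<^bsub>M\<^esub> b)"
      using F B coeff_closed[OF x] a
      by (intro M.finsum_cong') (auto simp: smult_assoc intro!: smult_closed)
    finally have sum: "a \<odot>\<^bsub>M\<^esub> x = (\<Oplus>\<^bsub>M\<^esub>b\<in>?F. ?c b \<odot>\<^bsub>M\<^esub> b)" .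
    have "{b. ?c b \<noteq> \<zero>\<^bsub>R\<^esub>} \<subseteq> ?F" using a by auto
    then have "repr (a \<odot>\<^bsub>M\<^esub> x) ?c"
      unfolding sum using F coeff_closed[OF x] a by (intro reprI) auto
    then show ?thesis using coeff_eqI x a smult_closed by auto
  qed
  have "repr b (\<lambda>a. if a = b then \<one>\<^bsub>R\<^esub> else \<zero>\<^bsub>R\<^esub>)"
  proof -
    have "(\<Oplus>\<^bsub>M\<^esub>a\<in>{b}. (if a = b then \<one>\<^bsub>R\<^esub> else \<zero>\<^bsub>R\<^esub>) \<odot>\<^bsub>M\<^esub> a) = b"
      using b B by (subst M.finsum_insert) (auto simp: smult_one M.finsum_empty)
    moreover have "repr (\<Oplus>\<^bsub>M\<^esub>a\<in>{b}. (if a = b then \<one>\<^bsub>R\<^esub> else \<zero>\<^bsub>R\<^esub>) \<odot>\<^bsub>M\<^esub> a)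
        (\<lambda>a. if a = b then \<one>\<^bsub>R\<^esub> else \<zero>\<^bsub>R\<^esub>)"
      using b by (intro reprI) auto
    ultimately show ?thesis by (simp only:)
  qed
  then have "coeff b b = \<one>\<^bsub>R\<^esub>" using coeff_eqI[of b] b B by auto
  then show ?thesis
    using add smult coeff_closed by (intro bexI[of _ "\<lambda>x. coeff x b"]) auto
qed

lemma additive_finsum:
  assumes "\<And>x y. x \<in> carrier M \<Longrightarrow> y \<in> carrier M \<Longrightarrow> h (x \<oplus>\<^bsub>M\<^esub> y) = (h x + h y :: 'd::ab_group_add)"
    and "finite A" "f \<in> A \<rightarrow> carrier M"
  shows "h (\<Oplus>\<^bsub>M\<^esub>x\<in>A. f x) = (\<Sum>x\<in>A. h (f x))"
  using assms(2,3)
proof (induction A rule: finite_induct)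
  case empty
  have "h \<zero>\<^bsub>M\<^esub> = h \<zero>\<^bsub>M\<^esub> + h \<zero>\<^bsub>M\<^esub>" using assms(1)[of "\<zero>\<^bsub>M\<^esub>" "\<zero>\<^bsub>M\<^esub>"] by simp
  then show ?case by (simp add: M.finsum_empty)
next
  case (insert x A)
  then have "f x \<in> carrier M" "f \<in> A \<rightarrow> carrier M" by auto
  then show ?case using insert assms(1) by (simp add: M.finsum_insert M.finsum_closed)
qed

end

section \<open>The kernel of the columns as a retract of a free module\<close>

text \<open>The \<open>k\<close> unimodular columns \<open>(\<alpha> (2 * i), \<alpha> (2 * i + 1))\<close> are left-inverted by the rows
  \<open>(\<epsilon> (2 * i), \<epsilon> (2 * i + 1))\<close>. The injection \<open>j\<close> into a type class ring serves to compute in \<open>R\<close>.\<close>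

locale unimodular_rows = ring R
  for R :: "'a ring" (structure) +
  fixes j :: "'a \<Rightarrow> 'c::ring_1" and \<alpha> \<epsilon> :: "nat \<Rightarrow> 'a" and k :: nat
  assumes j_inj: "inj_on j (carrier R)"
    and j_add: "\<lbrakk>a \<in> carrier R; b \<in> carrier R\<rbrakk> \<Longrightarrow> j (a \<oplus> b) = j a + j b"
    and j_mult: "\<lbrakk>a \<in> carrier R; b \<in> carrier R\<rbrakk> \<Longrightarrow> j (a \<otimes> b) = j a * j b"
    and j_one: "j \<one> = 1"
    and \<alpha>_closed: "\<alpha> n \<in> carrier R" and \<epsilon>_closed: "\<epsilon> n \<in> carrier R"
    and unimodular: "j (\<epsilon> (2 * i)) * j (\<alpha> (2 * i)) + j (\<epsilon> (2 * i + 1)) * j (\<alpha> (2 * i + 1)) = 1"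
begin

lemma j_zero: "j \<zero> = 0"
  using j_add[of \<zero> \<zero>] by simp

lemma j_uminus: "a \<in> carrier R \<Longrightarrow> j (\<ominus> a) = - j a"
  using j_add[of "\<ominus> a" a] by (simp add: l_neg j_zero eq_neg_iff_add_eq_0)

lemma j_minus: "a \<in> carrier R \<Longrightarrow> b \<in> carrier R \<Longrightarrow> j (a \<ominus> b) = j a - j b"
  by (simp add: a_minus_def j_add j_uminus)

lemmas j_simps = j_zero j_one j_add j_mult j_uminus j_minus

abbreviation "F n \<equiv> ring_power R n"

lemma F_simps:
  "x \<in> carrier (F n) \<longleftrightarrow> x \<in> {..<n} \<rightarrow>\<^sub>E carrier R"
  "\<zero>\<^bsub>F n\<^esub> = (\<lambda>i\<in>{..<n}. \<zero>)" "x \<oplus>\<^bsub>F n\<^esub> y = (\<lambda>i\<in>{..<n}. x i \<oplus> y i)"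
  "a \<odot>\<^bsub>F n\<^esub> x = (\<lambda>i\<in>{..<n}. a \<otimes> x i)"
  by (simp_all add: ring_power_def)

lemma F_closed: "x \<in> carrier (F n) \<Longrightarrow> i < n \<Longrightarrow> x i \<in> carrier R"
  by (auto simp: F_simps)

lemma F_eqI:
  assumes "x \<in> carrier (F n)" "y \<in> carrier (F n)" "\<And>i. i < n \<Longrightarrow> j (x i) = j (y i)"
  shows "x = y"
proof (rule PiE_ext)
  show "x \<in> {..<n} \<rightarrow>\<^sub>E carrier R" "y \<in> {..<n} \<rightarrow>\<^sub>E carrier R" using assms by (simp_all add: F_simps)
  fix i assume "i \<in> {..<n}"
  then show "x i = y i" using inj_onD[OF j_inj, of "x i" "y i"] assms F_closed by simp
qed

definition dot :: "(nat \<Rightarrow> 'a) \<Rightarrow> nat \<Rightarrow> 'a" where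
  "dot x i = x (2 * i) \<otimes> \<alpha> (2 * i) \<oplus> x (2 * i + 1) \<otimes> \<alpha> (2 * i + 1)"

text \<open>The direct sum of \<open>k\<close> kernels, realised inside one free module of rank
  \<open>2 * k\<close>: the entries \<open>2 * i\<close> and \<open>2 * i + 1\<close> hold the
  \<open>i\<close>-th summand.\<close>

definition K :: "('a, nat \<Rightarrow> 'a) module" where
  "K = (F (2 * k))\<lparr>carrier := {x \<in> carrier (F (2 * k)). \<forall>i<k. dot x i = \<zero>}\<rparr>"

lemma K_simps:
  "x \<in> carrier K \<longleftrightarrow> x \<in> carrier (F (2 * k)) \<and> (\<forall>i<k. dot x i = \<zero>)"
  "\<zero>\<^bsub>K\<^esub> = \<zero>\<^bsub>F (2 * k)\<^esub>" "x \<oplus>\<^bsub>K\<^esub> y = x \<oplus>\<^bsub>F (2 * k)\<^esub> y" "a \<odot>\<^bsub>K\<^esub> x = a \<odot>\<^bsub>F (2 * k)\<^esub> x"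
  by (simp_all add: K_def)

lemma dot_closed: "x \<in> carrier (F (2 * k)) \<Longrightarrow> i < k \<Longrightarrow> dot x i \<in> carrier R"
  by (simp add: dot_def F_closed[of x "2 * k"] \<alpha>_closed)

lemma j_dot:
  "x \<in> carrier (F (2 * k)) \<Longrightarrow> i < k \<Longrightarrow>
    j (dot x i) = j (x (2 * i)) * j (\<alpha> (2 * i)) + j (x (2 * i + 1)) * j (\<alpha> (2 * i + 1))"
  by (simp add: dot_def j_simps F_closed[of x "2 * k"] \<alpha>_closed)

lemma in_K_iff: "x \<in> carrier K \<longleftrightarrow> x \<in> carrier (F (2 * k)) \<and> (\<forall>i<k. j (dot x i) = 0)"
  using inj_onD[OF j_inj, of _ \<zero>] dot_closed by (auto simp: K_simps j_zero)

lemma F_ops_closed: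
  "\<zero>\<^bsub>F n\<^esub> \<in> carrier (F n)"
  "x \<in> carrier (F n) \<Longrightarrow> y \<in> carrier (F n) \<Longrightarrow> x \<oplus>\<^bsub>F n\<^esub> y \<in> carrier (F n)"
  "a \<in> carrier R \<Longrightarrow> x \<in> carrier (F n) \<Longrightarrow> a \<odot>\<^bsub>F n\<^esub> x \<in> carrier (F n)"
  by (auto simp: F_simps)

lemma F_nth:
  "i < n \<Longrightarrow> j (\<zero>\<^bsub>F n\<^esub> i) = 0"
  "i < n \<Longrightarrow> x \<in> carrier (F n) \<Longrightarrow> y \<in> carrier (F n) \<Longrightarrow> j ((x \<oplus>\<^bsub>F n\<^esub> y) i) = j (x i) + j (y i)"
  "i < n \<Longrightarrow> a \<in> carrier R \<Longrightarrow> x \<in> carrier (F n) \<Longrightarrow> j ((a \<odot>\<^bsub>F n\<^esub> x) i) = j a * j (x i)"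
  using F_closed[of x n i] F_closed[of y n i] by (auto simp: F_simps(2-4) j_simps)

lemma j_dot_ops:
  assumes "i < k"
  shows "j (dot \<zero>\<^bsub>F (2 * k)\<^esub> i) = 0"
    and "x \<in> carrier (F (2 * k)) \<Longrightarrow> y \<in> carrier (F (2 * k)) \<Longrightarrow>
      j (dot (x \<oplus>\<^bsub>F (2 * k)\<^esub> y) i) = j (dot x i) + j (dot y i)"
    and "a \<in> carrier R \<Longrightarrow> x \<in> carrier (F (2 * k)) \<Longrightarrow>
      j (dot (a \<odot>\<^bsub>F (2 * k)\<^esub> x) i) = j a * j (dot x i)"
proof -
  have i: "2 * i < 2 * k" "2 * i + 1 < 2 * k" using assms by simp_all
  show "j (dot \<zero>\<^bsub>F (2 * k)\<^esub> i) = 0"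
    by (subst j_dot[OF F_ops_closed(1) assms]) (simp only: i F_nth mult_zero_left add_0)
  show "j (dot (x \<oplus>\<^bsub>F (2 * k)\<^esub> y) i) = j (dot x i) + j (dot y i)"
    if "x \<in> carrier (F (2 * k))" "y \<in> carrier (F (2 * k))"
    by (simp only: j_dot[OF F_ops_closed(2)[OF that] assms] j_dot[OF that(1) assms]
        j_dot[OF that(2) assms] F_nth(2)[OF i(1) that] F_nth(2)[OF i(2) that] distrib_right add.assoc add.left_commute)
  show "j (dot (a \<odot>\<^bsub>F (2 * k)\<^esub> x) i) = j a * j (dot x i)"
    if "a \<in> carrier R" "x \<in> carrier (F (2 * k))"
    by (simp only: j_dot[OF F_ops_closed(3)[OF that] assms] j_dot[OF that(2) assms]
        F_nth(3)[OF i(1) that] F_nth(3)[OF i(2) that] distrib_left mult.assoc)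
qed

lemma K_ops_closed:
  "\<zero>\<^bsub>K\<^esub> \<in> carrier K"
  "x \<in> carrier K \<Longrightarrow> y \<in> carrier K \<Longrightarrow> x \<oplus>\<^bsub>K\<^esub> y \<in> carrier K"
  "a \<in> carrier R \<Longrightarrow> x \<in> carrier K \<Longrightarrow> a \<odot>\<^bsub>K\<^esub> x \<in> carrier K"
  unfolding in_K_iff unfolding K_simps by (simp_all add: F_ops_closed j_dot_ops)

lemma K_F: "x \<in> carrier K \<Longrightarrow> x \<in> carrier (F (2 * k))"
  by (simp add: K_simps)

lemmas F_arith = F_ops_closed F_nth j_simps ring_distribs mult.assoc add.assoc add.commute add.left_commute

lemma abelian_group_K: "abelian_group K"
proof (rule abelian_groupI)
  fix x assume x: "x \<in> carrier K"
  have "(\<ominus> \<one>) \<odot>\<^bsub>K\<^esub> x \<oplus>\<^bsub>K\<^esub> x = \<zero>\<^bsub>K\<^esub>"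
    unfolding K_simps using K_F[OF x] by (intro F_eqI[of _ "2 * k"]) (simp_all add: F_arith)
  then show "\<exists>y\<in>carrier K. y \<oplus>\<^bsub>K\<^esub> x = \<zero>\<^bsub>K\<^esub>" using K_ops_closed(3) x by blast
  show "\<zero>\<^bsub>K\<^esub> \<oplus>\<^bsub>K\<^esub> x = x"
    unfolding K_simps using K_F[OF x] by (intro F_eqI[of _ "2 * k"]) (simp_all add: F_arith)
  fix y assume y: "y \<in> carrier K"
  show "x \<oplus>\<^bsub>K\<^esub> y = y \<oplus>\<^bsub>K\<^esub> x"
    unfolding K_simps using K_F[OF x] K_F[OF y] by (intro F_eqI[of _ "2 * k"]) (simp_all add: F_arith)
  fix z assume z: "z \<in> carrier K"
  show "x \<oplus>\<^bsub>K\<^esub> y \<oplus>\<^bsub>K\<^esub> z = x \<oplus>\<^bsub>K\<^esub> (y \<oplus>\<^bsub>K\<^esub> z)"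
    unfolding K_simps using K_F[OF x] K_F[OF y] K_F[OF z] by (intro F_eqI[of _ "2 * k"]) (simp_all add: F_arith)
qed (use K_ops_closed in simp_all)

lemma left_module_K: "left_module R K"
proof (intro left_module.intro left_module_axioms.intro)
  show "ring R" by (rule ring_axioms)
  show "abelian_group K" by (rule abelian_group_K)
  fix a x assume a: "a \<in> carrier R" and x: "x \<in> carrier K"
  show "a \<odot>\<^bsub>K\<^esub> x \<in> carrier K" using a x by (rule K_ops_closed)
  { fix b assume b: "b \<in> carrier R"
    show "(a \<oplus> b) \<odot>\<^bsub>K\<^esub> x = a \<odot>\<^bsub>K\<^esub> x \<oplus>\<^bsub>K\<^esub> b \<odot>\<^bsub>K\<^esub> x"
      unfolding K_simps using K_F[OF x] a b by (intro F_eqI[of _ "2 * k"]) (simp_all add: F_arith)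
    show "(a \<otimes> b) \<odot>\<^bsub>K\<^esub> x = a \<odot>\<^bsub>K\<^esub> (b \<odot>\<^bsub>K\<^esub> x)"
      unfolding K_simps using K_F[OF x] a b by (intro F_eqI[of _ "2 * k"]) (simp_all add: F_arith) }
  { fix y assume y: "y \<in> carrier K"
    show "a \<odot>\<^bsub>K\<^esub> (x \<oplus>\<^bsub>K\<^esub> y) = a \<odot>\<^bsub>K\<^esub> x \<oplus>\<^bsub>K\<^esub> a \<odot>\<^bsub>K\<^esub> y"
      unfolding K_simps using K_F[OF x] K_F[OF y] a by (intro F_eqI[of _ "2 * k"]) (simp_all add: F_arith) }
next
  fix x assume x: "x \<in> carrier K"
  show "\<one> \<odot>\<^bsub>K\<^esub> x = x"
    unfolding K_simps using K_F[OF x] by (intro F_eqI[of _ "2 * k"]) (simp_all add: F_arith)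
qed

text \<open>As the rows invert the columns, subtracting \<open>dot x i\<close> times the
  \<open>i\<close>-th row for every \<open>i\<close> is an idempotent map of the free module onto
  \<open>K\<close>.\<close>

definition proj :: "(nat \<Rightarrow> 'a) \<Rightarrow> nat \<Rightarrow> 'a" where
  "proj x = (\<lambda>n\<in>{..<2 * k}. x n \<ominus> dot x (n div 2) \<otimes> \<epsilon> n)"

lemma div_2_less: "n < 2 * k \<Longrightarrow> n div 2 < k"
  by simp

lemma proj_F:
  assumes x: "x \<in> carrier (F (2 * k))"
  shows "proj x \<in> carrier (F (2 * k))"
proof -
  have "x n \<ominus> dot x (n div 2) \<otimes> \<epsilon> n \<in> carrier R" if "n < 2 * k" for n
    using F_closed[OF x that] dot_closed[OF x div_2_less[OF that]] \<epsilon>_closed by simp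
  then show ?thesis unfolding F_simps proj_def by (simp add: restrict_PiE_iff)
qed

lemma j_proj:
  assumes x: "x \<in> carrier (F (2 * k))" and n: "n < 2 * k"
  shows "j (proj x n) = j (x n) - j (dot x (n div 2)) * j (\<epsilon> n)"
  using F_closed[OF x n] dot_closed[OF x div_2_less[OF n]] n
  by (simp add: proj_def j_simps \<epsilon>_closed)

lemma proj_K:
  assumes x: "x \<in> carrier (F (2 * k))"
  shows "proj x \<in> carrier K"
  unfolding in_K_iff
proof (intro conjI allI impI proj_F x)
  fix i assume i: "i < k"
  then have 2: "2 * i < 2 * k" "2 * i + 1 < 2 * k" by simp_all
  let ?t = "j (dot x i)"
  have "j (dot (proj x) i) = (j (x (2 * i)) - ?t * j (\<epsilon> (2 * i))) * j (\<alpha> (2 * i))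
      + (j (x (2 * i + 1)) - ?t * j (\<epsilon> (2 * i + 1))) * j (\<alpha> (2 * i + 1))"
    using j_dot[OF proj_F[OF x] i] j_proj[OF x 2(1)] j_proj[OF x 2(2)] by simp
  also have "\<dots> = j (dot x i)
      - ?t * (j (\<epsilon> (2 * i)) * j (\<alpha> (2 * i)) + j (\<epsilon> (2 * i + 1)) * j (\<alpha> (2 * i + 1)))"
    unfolding j_dot[OF x i] by (simp add: algebra_simps)
  also have "\<dots> = 0" by (simp only: unimodular mult_1_right diff_self)
  finally show "j (dot (proj x) i) = 0" .
qed

lemma proj_id:
  assumes x: "x \<in> carrier K"
  shows "proj x = x"
proof (rule F_eqI[of _ "2 * k"])
  fix n assume n: "n < 2 * k"
  show "j (proj x n) = j (x n)"
    using x div_2_less[OF n] by (simp add: j_proj[OF K_F[OF x] n] in_K_iff)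
qed (use K_F[OF x] proj_F in auto)

lemma proj_add:
  assumes x: "x \<in> carrier (F (2 * k))" and y: "y \<in> carrier (F (2 * k))"
  shows "proj (x \<oplus>\<^bsub>F (2 * k)\<^esub> y) = proj x \<oplus>\<^bsub>K\<^esub> proj y"
  unfolding K_simps
proof (rule F_eqI[of _ "2 * k"])
  fix n assume n: "n < 2 * k"
  show "j (proj (x \<oplus>\<^bsub>F (2 * k)\<^esub> y) n) = j ((proj x \<oplus>\<^bsub>F (2 * k)\<^esub> proj y) n)"
    using j_dot_ops(2)[OF div_2_less[OF n] x y]
    by (simp add: x y n j_proj F_ops_closed F_nth proj_F distrib_right)
qed (simp_all add: x y F_ops_closed proj_F)

lemma proj_smult:
  assumes a: "a \<in> carrier R" and x: "x \<in> carrier (F (2 * k))"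
  shows "proj (a \<odot>\<^bsub>F (2 * k)\<^esub> x) = a \<odot>\<^bsub>K\<^esub> proj x"
  unfolding K_simps
proof (rule F_eqI[of _ "2 * k"])
  fix n assume n: "n < 2 * k"
  show "j (proj (a \<odot>\<^bsub>F (2 * k)\<^esub> x) n) = j ((a \<odot>\<^bsub>F (2 * k)\<^esub> proj x) n)"
    using j_dot_ops(3)[OF div_2_less[OF n] a x]
    by (simp add: x a n j_proj F_ops_closed F_nth proj_F right_diff_distrib mult.assoc)
qed (simp_all add: x a F_ops_closed proj_F)

end

section \<open>Stable freeness, and the consequence of freeness\<close>

context unimodular_rows
begin

definition lift :: "(nat \<Rightarrow> 'a) \<Rightarrow> nat \<Rightarrow> 'a" where
  "lift y = (\<lambda>n\<in>{..<2 * k}. y (n div 2) \<otimes> \<epsilon> n)"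

lemma lift_F: "y \<in> carrier (F k) \<Longrightarrow> lift y \<in> carrier (F (2 * k))"
  using F_closed[of y k] \<epsilon>_closed div_2_less
  by (simp add: F_simps(1)[of _ "2 * k"] lift_def restrict_PiE_iff)

lemma j_lift: "y \<in> carrier (F k) \<Longrightarrow> n < 2 * k \<Longrightarrow> j (lift y n) = j (y (n div 2)) * j (\<epsilon> n)"
  using F_closed[of y k] \<epsilon>_closed div_2_less by (simp add: lift_def j_simps)

lemma j_dot_lift:
  assumes y: "y \<in> carrier (F k)" and i: "i < k"
  shows "j (dot (lift y) i) = j (y i)"
proof -
  have 2: "2 * i < 2 * k" "2 * i + 1 < 2 * k" using i by simp_all
  have "j (dot (lift y) i) = j (y i) * (j (\<epsilon> (2 * i)) * j (\<alpha> (2 * i)) + j (\<epsilon> (2 * i + 1)) * j (\<alpha> (2 * i + 1)))"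
    unfolding j_dot[OF lift_F[OF y] i] j_lift[OF y 2(1)] j_lift[OF y 2(2)]
    by (simp add: distrib_left mult.assoc)
  then show ?thesis by (simp only: unimodular mult_1_right)
qed

definition coef :: "(nat \<Rightarrow> 'a) \<Rightarrow> nat \<Rightarrow> 'a" where
  "coef z = (\<lambda>i\<in>{..<k}. dot z i)"

lemma coef_F: "z \<in> carrier (F (2 * k)) \<Longrightarrow> coef z \<in> carrier (F k)"
  using dot_closed[of z] by (simp add: F_simps(1)[of _ k] coef_def restrict_PiE_iff)

lemma module_sum_simps:
  "carrier (module_sum M N) = carrier M \<times> carrier N"
  "(x, y) \<oplus>\<^bsub>module_sum M N\<^esub> (x', y') = (x \<oplus>\<^bsub>M\<^esub> x', y \<oplus>\<^bsub>N\<^esub> y')"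
  "a \<odot>\<^bsub>module_sum M N\<^esub> (x, y) = (a \<odot>\<^bsub>M\<^esub> x, a \<odot>\<^bsub>N\<^esub> y)"
  by (simp_all add: module_sum_def)

text \<open>The map \<open>lift\<close> splits \<open>coef\<close>, whose kernel is
  \<open>K\<close>; so the free module is the sum of \<open>K\<close> and a copy of
  \<open>F k\<close>.\<close>

lemma module_isomorphic_K_sum: "module_isomorphic R (module_sum K (F k)) (F (2 * k))"
proof -
  let ?f = "\<lambda>(x, y). x \<oplus>\<^bsub>F (2 * k)\<^esub> lift y" and ?g = "\<lambda>z. (proj z, coef z)"
  have gf: "?g (x \<oplus>\<^bsub>F (2 * k)\<^esub> lift y) = (x, y)" if x: "x \<in> carrier K" and y: "y \<in> carrier (F k)" for x y
  proof -
    let ?z = "x \<oplus>\<^bsub>F (2 * k)\<^esub> lift y"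
    have z: "?z \<in> carrier (F (2 * k))" using K_F[OF x] lift_F[OF y] by (simp add: F_ops_closed)
    have dot: "j (dot ?z i) = j (y i)" if "i < k" for i
      using x that j_dot_ops(2)[OF that K_F[OF x] lift_F[OF y]] j_dot_lift[OF y that]
      by (simp add: in_K_iff)
    have "proj ?z = x"
    proof (rule F_eqI[of _ "2 * k"])
      fix n assume n: "n < 2 * k"
      show "j (proj ?z n) = j (x n)"
        using dot[OF div_2_less[OF n]] n j_lift[OF y n]
        by (simp add: j_proj[OF z n] F_nth(2)[OF n K_F[OF x] lift_F[OF y]])
    qed (use z K_F[OF x] proj_F in auto)
    moreover have "coef ?z = y"
      by (rule F_eqI[of _ k]) (use z y coef_F dot in \<open>auto simp: coef_def\<close>)
    ultimately show ?thesis by simp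
  qed
  have fg: "proj z \<oplus>\<^bsub>F (2 * k)\<^esub> lift (coef z) = z" if z: "z \<in> carrier (F (2 * k))" for z
  proof (rule F_eqI[of _ "2 * k"])
    fix n assume n: "n < 2 * k"
    show "j ((proj z \<oplus>\<^bsub>F (2 * k)\<^esub> lift (coef z)) n) = j (z n)"
      unfolding F_nth(2)[OF n proj_F[OF z] lift_F[OF coef_F[OF z]]] j_proj[OF z n]
        j_lift[OF coef_F[OF z] n]
      using div_2_less[OF n] by (simp add: coef_def)
  qed (use z proj_F lift_F coef_F F_ops_closed in auto)
  have "bij_betw ?f (carrier (module_sum K (F k))) (carrier (F (2 * k)))"
    by (rule bij_betw_byWitness[of _ ?g])
       (use gf fg K_F lift_F coef_F proj_K F_ops_closed in \<open>auto simp: module_sum_simps\<close>)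
  moreover have "?f (p \<oplus>\<^bsub>module_sum K (F k)\<^esub> q) = ?f p \<oplus>\<^bsub>F (2 * k)\<^esub> ?f q"
    if pq: "p \<in> carrier (module_sum K (F k))" "q \<in> carrier (module_sum K (F k))" for p q
  proof -
    obtain x y x' y' where p: "p = (x, y)" "q = (x', y')" by (cases p, cases q) auto
    with pq have c: "x \<in> carrier (F (2 * k))" "x' \<in> carrier (F (2 * k))" "y \<in> carrier (F k)" "y' \<in> carrier (F k)"
      by (auto simp: module_sum_simps K_F)
    note l = lift_F[OF c(3)] lift_F[OF c(4)] lift_F[OF F_ops_closed(2)[OF c(3,4)]]
    have "x \<oplus>\<^bsub>F (2 * k)\<^esub> x' \<oplus>\<^bsub>F (2 * k)\<^esub> lift (y \<oplus>\<^bsub>F k\<^esub> y')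
        = x \<oplus>\<^bsub>F (2 * k)\<^esub> lift y \<oplus>\<^bsub>F (2 * k)\<^esub> (x' \<oplus>\<^bsub>F (2 * k)\<^esub> lift y')"
      by (rule F_eqI[of _ "2 * k"])
         (simp_all add: c l F_ops_closed F_nth j_lift div_2_less distrib_right add.assoc add.left_commute)
    then show ?thesis by (simp add: p module_sum_simps K_simps)
  qed
  moreover have "?f (a \<odot>\<^bsub>module_sum K (F k)\<^esub> p) = a \<odot>\<^bsub>F (2 * k)\<^esub> ?f p"
    if a: "a \<in> carrier R" and p: "p \<in> carrier (module_sum K (F k))" for a p
  proof -
    obtain x y where xy: "p = (x, y)" by (cases p) auto
    with p have c: "x \<in> carrier (F (2 * k))" "y \<in> carrier (F k)"
      by (auto simp: module_sum_simps K_F)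
    note l = lift_F[OF c(2)] lift_F[OF F_ops_closed(3)[OF a c(2)]]
    have "a \<odot>\<^bsub>F (2 * k)\<^esub> x \<oplus>\<^bsub>F (2 * k)\<^esub> lift (a \<odot>\<^bsub>F k\<^esub> y) = a \<odot>\<^bsub>F (2 * k)\<^esub> (x \<oplus>\<^bsub>F (2 * k)\<^esub> lift y)"
      by (rule F_eqI[of _ "2 * k"])
         (simp_all add: a c l F_ops_closed F_nth j_lift div_2_less distrib_left mult.assoc)
    then show ?thesis by (simp add: xy module_sum_simps K_simps)
  qed
  ultimately have "?f \<in> module_iso R (module_sum K (F k)) (F (2 * k))"
    unfolding module_iso_def by blast
  then show ?thesis unfolding module_isomorphic_def by blast
qed

definition unit_vector :: "nat \<Rightarrow> nat \<Rightarrow> 'a" where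
  "unit_vector n = (\<lambda>i\<in>{..<2 * k}. if i = n then \<one> else \<zero>)"

lemma unit_vector_F: "unit_vector n \<in> carrier (F (2 * k))"
  by (simp add: F_simps(1) unit_vector_def restrict_PiE_iff)

lemma j_unit_vector: "i < 2 * k \<Longrightarrow> j (unit_vector n i) = (if i = n then 1 else 0)"
  by (simp add: unit_vector_def j_simps)

lemma K_generated:
  assumes x: "x \<in> carrier K"
  shows "x = (\<Oplus>\<^bsub>K\<^esub>n\<in>{..<2 * k}. x n \<odot>\<^bsub>K\<^esub> proj (unit_vector n))"
proof -
  interpret K: left_module R K by (rule left_module_K)
  \<comment> \<open>The expansion of \<open>x\<close> in unit vectors is built up one entry at a
    time, as \<open>proj\<close> is known to be additive on two summands.\<close>
  define trunc where "trunc m = (\<lambda>i\<in>{..<2 * k}. if i < m then x i else \<zero>)" for m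
  have xF: "x \<in> carrier (F (2 * k))" using x by (rule K_F)
  have trunc_F: "trunc m \<in> carrier (F (2 * k))" for m
    using F_closed[OF xF] by (simp add: F_simps(1) trunc_def restrict_PiE_iff)
  have "proj (trunc m) = (\<Oplus>\<^bsub>K\<^esub>n\<in>{..<m}. x n \<odot>\<^bsub>K\<^esub> proj (unit_vector n))" if "m \<le> 2 * k" for m
    using that
  proof (induction m)
    case 0
    have "trunc 0 = \<zero>\<^bsub>K\<^esub>" by (simp add: trunc_def K_simps F_simps)
    then show ?case using proj_id[OF K_ops_closed(1)] by simp
  next
    case (Suc m)
    then have m: "m < 2 * k" by simp
    have xm: "x m \<in> carrier R" using F_closed[OF xF m] .
    have "trunc (Suc m) = trunc m \<oplus>\<^bsub>F (2 * k)\<^esub> (x m \<odot>\<^bsub>F (2 * k)\<^esub> unit_vector m)"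
    proof (rule F_eqI[of _ "2 * k"])
      fix i assume i: "i < 2 * k"
      show "j (trunc (Suc m) i) = j ((trunc m \<oplus>\<^bsub>F (2 * k)\<^esub> (x m \<odot>\<^bsub>F (2 * k)\<^esub> unit_vector m)) i)"
        using i xm by (simp add: F_nth trunc_F unit_vector_F F_ops_closed j_unit_vector)
          (simp add: trunc_def j_simps)
    qed (use trunc_F unit_vector_F xm F_ops_closed in auto)
    then have "proj (trunc (Suc m)) = proj (trunc m) \<oplus>\<^bsub>K\<^esub> x m \<odot>\<^bsub>K\<^esub> proj (unit_vector m)"
      using xm by (simp add: proj_add proj_smult trunc_F unit_vector_F F_ops_closed)
    also have "\<dots> = (\<Oplus>\<^bsub>K\<^esub>n\<in>{..<Suc m}. x n \<odot>\<^bsub>K\<^esub> proj (unit_vector n))"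
    proof -
      have "(\<lambda>n. x n \<odot>\<^bsub>K\<^esub> proj (unit_vector n)) \<in> {..<m} \<rightarrow> carrier K"
        using m F_closed[OF xF] by (auto intro!: K_ops_closed proj_K unit_vector_F)
      then show ?thesis
        using Suc xm by (simp add: lessThan_Suc K.M.finsum_insert K.M.finsum_closed K.M.a_comm
            K_ops_closed proj_K unit_vector_F)
    qed
    finally show ?case .
  qed
  from this[of "2 * k"] have "proj (trunc (2 * k)) = (\<Oplus>\<^bsub>K\<^esub>n\<in>{..<2 * k}. x n \<odot>\<^bsub>K\<^esub> proj (unit_vector n))"
    by simp
  moreover have "trunc (2 * k) = x"
    by (rule F_eqI[of _ "2 * k"]) (use trunc_F xF in \<open>auto simp: trunc_def\<close>)
  ultimately show ?thesis using proj_id[OF x] by simp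
qed

lemma stably_free_K: "stably_free_of_rank R K (int k)"
proof -
  interpret K: left_module R K by (rule left_module_K)
  let ?A = "(\<lambda>n. proj (unit_vector n)) ` {..<2 * k}"
  have "finitely_generated_module R K"
    unfolding finitely_generated_module_def
  proof (intro exI[of _ ?A] conjI ballI)
    fix x assume x: "x \<in> carrier K"
    have "\<exists>c\<in>?A \<rightarrow> carrier R. (\<Oplus>\<^bsub>K\<^esub>n\<in>{..<2 * k}. x n \<odot>\<^bsub>K\<^esub> proj (unit_vector n)) = (\<Oplus>\<^bsub>K\<^esub>a\<in>?A. c a \<odot>\<^bsub>K\<^esub> a)"
      by (rule K.finsum_regroup) (use F_closed[OF K_F[OF x]] in \<open>auto intro!: proj_K unit_vector_F\<close>)
    then show "\<exists>c\<in>?A \<rightarrow> carrier R. x = (\<Oplus>\<^bsub>K\<^esub>a\<in>?A. c a \<odot>\<^bsub>K\<^esub> a)"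
      by (subst K_generated[OF x])
  qed (auto intro!: proj_K unit_vector_F)
  then show ?thesis
    unfolding stably_free_of_rank_def
    using left_module_K module_isomorphic_K_sum
    by (intro conjI exI[of _ k] exI[of _ "2 * k"]) auto
qed

text \<open>Before projection the combination is the \<open>i\<close>-th row itself, and
  \<open>proj\<close> kills the rows. Linear maps on \<open>K\<close> therefore send the two
  generators to a solution of the row equation.\<close>

lemma unit_vector_relation:
  assumes i: "i < k"
  shows "\<epsilon> (2 * i) \<odot>\<^bsub>K\<^esub> proj (unit_vector (2 * i)) \<oplus>\<^bsub>K\<^esub> \<epsilon> (2 * i + 1) \<odot>\<^bsub>K\<^esub> proj (unit_vector (2 * i + 1)) = \<zero>\<^bsub>K\<^esub>"
proof -
  define z where "z = \<epsilon> (2 * i) \<odot>\<^bsub>F (2 * k)\<^esub> unit_vector (2 * i) \<oplus>\<^bsub>F (2 * k)\<^esub> \<epsilon> (2 * i + 1) \<odot>\<^bsub>F (2 * k)\<^esub> unit_vector (2 * i + 1)"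
  have z: "z \<in> carrier (F (2 * k))" by (simp add: z_def F_ops_closed unit_vector_F \<epsilon>_closed)
  have jz: "j (z n) = (if n div 2 = i then j (\<epsilon> n) else 0)" if "n < 2 * k" for n
    using that by (auto simp: z_def F_nth F_ops_closed unit_vector_F \<epsilon>_closed j_unit_vector)
  have dot: "j (dot z l) = (if l = i then 1 else 0)" if l: "l < k" for l
  proof -
    have "2 * l < 2 * k" "2 * l + 1 < 2 * k" using l by simp_all
    then show ?thesis using unimodular[of i] by (auto simp: j_dot[OF z l] jz)
  qed
  have "proj z = \<zero>\<^bsub>K\<^esub>"
  proof (rule F_eqI[of _ "2 * k"])
    fix n assume n: "n < 2 * k"
    show "j (proj z n) = j (\<zero>\<^bsub>K\<^esub> n)"
      using dot[OF div_2_less[OF n]] by (simp add: j_proj[OF z n] jz[OF n] K_simps F_nth(1)[OF n])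
  qed (use z proj_F K_F[OF K_ops_closed(1)] in auto)
  then show ?thesis
    by (simp add: z_def proj_add proj_smult F_ops_closed unit_vector_F \<epsilon>_closed)
qed

text \<open>A coordinate function on \<open>K\<close> takes the value 1, and its values on the
  generators of the \<open>i\<close>-th summand are \<open>v i\<close> and \<open>w i\<close>. The
  hypothesis \<open>not_unit\<close> makes \<open>proj (unit_vector 1)\<close> nonzero, so that the
  basis is not empty.\<close>

lemma free_imp:
  assumes k: "k > 0" and free: "free_module R K" and not_unit: "j (\<alpha> 1) * j (\<epsilon> 1) \<noteq> 1"
  shows "\<exists>v w A B. (\<forall>i<k. j (\<epsilon> (2 * i)) * v i + j (\<epsilon> (2 * i + 1)) * w i = 0) \<and>
           1 = (\<Sum>i<k. A i * v i + B i * w i)"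
proof -
  interpret K: left_module R K by (rule left_module_K)
  obtain B where B: "module_basis R K B" using free by (auto simp: free_module_def)
  have "B \<noteq> {}"
  proof
    assume "B = {}"
    let ?x = "proj (unit_vector 1)"
    have x: "?x \<in> carrier K" by (intro proj_K unit_vector_F)
    then obtain c where "{b. c b \<noteq> \<zero>} \<subseteq> B" "?x = (\<Oplus>\<^bsub>K\<^esub>b\<in>{b. c b \<noteq> \<zero>}. c b \<odot>\<^bsub>K\<^esub> b)"
      using B unfolding module_basis_def by blast
    then have "?x = \<zero>\<^bsub>K\<^esub>" using \<open>B = {}\<close> by simp
    moreover have "j (?x 1) = 1 - j (\<alpha> 1) * j (\<epsilon> 1)"
      using k j_proj[OF unit_vector_F, of 1 1] j_dot[OF unit_vector_F k, of 1] by (simp add: j_unit_vector)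
    ultimately show False using not_unit k F_nth(1)[of 1 "2 * k"] by (simp add: K_simps)
  qed
  then obtain b where b: "b \<in> B" by blast
  have "\<one> \<noteq> \<zero>" using j_one j_zero by auto
  from K.basis_coordinate[OF B b this] obtain \<phi> where
    \<phi>: "\<phi> \<in> carrier K \<rightarrow> carrier R" "\<phi> b = \<one>"
      "\<And>x y. x \<in> carrier K \<Longrightarrow> y \<in> carrier K \<Longrightarrow> \<phi> (x \<oplus>\<^bsub>K\<^esub> y) = \<phi> x \<oplus> \<phi> y"
      "\<And>a x. a \<in> carrier R \<Longrightarrow> x \<in> carrier K \<Longrightarrow> \<phi> (a \<odot>\<^bsub>K\<^esub> x) = a \<otimes> \<phi> x"
    by blast
  define h where "h x = j (\<phi> x)" for x
  have \<phi>_closed: "x \<in> carrier K \<Longrightarrow> \<phi> x \<in> carrier R" for x using \<phi>(1) by auto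
  have h_add: "h (x \<oplus>\<^bsub>K\<^esub> y) = h x + h y" if "x \<in> carrier K" "y \<in> carrier K" for x y
    using that by (simp add: h_def \<phi> \<phi>_closed j_simps)
  have h_smult: "h (a \<odot>\<^bsub>K\<^esub> x) = j a * h x" if "a \<in> carrier R" "x \<in> carrier K" for a x
    using that by (simp add: h_def \<phi> \<phi>_closed j_simps)
  have h_zero: "h \<zero>\<^bsub>K\<^esub> = 0" using h_add[of "\<zero>\<^bsub>K\<^esub>" "\<zero>\<^bsub>K\<^esub>"] by simp
  have bK: "b \<in> carrier K" using B b by (auto simp: module_basis_def)
  let ?e = "\<lambda>n. proj (unit_vector n)"
  have e: "?e n \<in> carrier K" for n by (intro proj_K unit_vector_F)
  have "1 = h b" using \<phi>(2) by (simp add: h_def j_one)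
  also have "\<dots> = h (\<Oplus>\<^bsub>K\<^esub>n\<in>{..<2 * k}. b n \<odot>\<^bsub>K\<^esub> ?e n)"
    using K_generated[OF bK] by simp
  also have "\<dots> = (\<Sum>n<2 * k. h (b n \<odot>\<^bsub>K\<^esub> ?e n))"
    by (rule K.additive_finsum[OF h_add]) (use e F_closed[OF K_F[OF bK]] in \<open>auto intro!: K_ops_closed\<close>)
  also have "\<dots> = (\<Sum>n<2 * k. j (b n) * h (?e n))"
    by (rule sum.cong[OF refl], rule h_smult) (use F_closed[OF K_F[OF bK]] e in auto)
  also have "\<dots> = (\<Sum>i<k. j (b (2 * i)) * h (?e (2 * i)) + j (b (2 * i + 1)) * h (?e (2 * i + 1)))"
  proof -
    have "(\<Sum>n<2 * m. f n) = (\<Sum>i<m. f (2 * i) + f (2 * i + 1))" for m and f :: "nat \<Rightarrow> 'c"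
      by (induction m) (simp_all add: add.assoc)
    then show ?thesis .
  qed
  finally have one: "1 = (\<Sum>i<k. j (b (2 * i)) * h (?e (2 * i)) + j (b (2 * i + 1)) * h (?e (2 * i + 1)))" .
  have rel: "j (\<epsilon> (2 * i)) * h (?e (2 * i)) + j (\<epsilon> (2 * i + 1)) * h (?e (2 * i + 1)) = 0" if "i < k" for i
  proof -
    note cl = \<epsilon>_closed[of "2 * i"] \<epsilon>_closed[of "2 * i + 1"] e[of "2 * i"] e[of "2 * i + 1"]
    show ?thesis
      using arg_cong[OF unit_vector_relation[OF that], of h]
      unfolding h_add[OF K_ops_closed(3)[OF cl(1,3)] K_ops_closed(3)[OF cl(2,4)]]
        h_smult[OF cl(1,3)] h_smult[OF cl(2,4)] h_zero .
  qed
  show ?thesis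
    by (rule exI[of _ "\<lambda>i. h (?e (2 * i))"], rule exI[of _ "\<lambda>i. h (?e (2 * i + 1))"],
        rule exI[of _ "\<lambda>i. j (b (2 * i))"], rule exI[of _ "\<lambda>i. j (b (2 * i + 1))"])
       (use rel one in simp)
qed

end

section \<open>Transport of a countable group and its group ring to codes in the natural
  numbers\<close>

definition nat_copy :: "'g::{group_add, countable} itself \<Rightarrow> nat monoid" where
  "nat_copy _ = \<lparr>carrier = range (to_nat :: 'g \<Rightarrow> nat),
     monoid.mult = (\<lambda>a b. to_nat (from_nat a + from_nat b :: 'g)), monoid.one = to_nat (0 :: 'g)\<rparr>"

lemma group_nat_copy: "group (nat_copy TYPE('g::{group_add, countable}))"
proof (rule groupI)
  fix x assume "x \<in> carrier (nat_copy TYPE('g))"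
  then obtain g :: 'g where "x = to_nat g" by (auto simp: nat_copy_def)
  then show "\<exists>y\<in>carrier (nat_copy TYPE('g)). y \<otimes>\<^bsub>nat_copy TYPE('g)\<^esub> x = \<one>\<^bsub>nat_copy TYPE('g)\<^esub>"
    by (intro bexI[of _ "to_nat (- g)"]) (simp_all add: nat_copy_def)
qed (auto simp: nat_copy_def add.assoc)

abbreviation group_ring :: "'g::{group_add, countable} itself \<Rightarrow> (nat \<Rightarrow>\<^sub>0 int) ring" where
  "group_ring t \<equiv> integral_group_ring (nat_copy t)"

abbreviation encode :: "('g::{group_add, countable} \<Rightarrow>\<^sub>0 int) \<Rightarrow> nat \<Rightarrow>\<^sub>0 int" where
  "encode \<equiv> push_forward to_nat"

text \<open>Restriction to the codes, inverse to \<open>encode\<close> on the mappings supported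
  there. It is the injection into a type class ring on which \<open>unimodular_rows\<close> is
  based.\<close>

abbreviation decode :: "(nat \<Rightarrow>\<^sub>0 int) \<Rightarrow> 'g::{group_add, countable} \<Rightarrow>\<^sub>0 int" where
  "decode \<equiv> Poly_Mapping.map_key to_nat"

lemma lookup_push_forward_inj:
  assumes "inj f"
  shows "Poly_Mapping.lookup (push_forward f p) (f x) = Poly_Mapping.lookup p x"
proof -
  have "Poly_Mapping.lookup (push_forward f p) (f x)
      = (\<Sum>y\<in>Poly_Mapping.keys p. if y = x then Poly_Mapping.lookup p y else 0)"
    unfolding push_forward_def lookup_sum
    by (rule sum.cong) (auto simp: lookup_single inj_eq[OF assms] when_def)
  also have "\<dots> = Poly_Mapping.lookup p x"
    by (simp add: in_keys_iff)
  finally show ?thesis .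
qed

lemma decode_encode [simp]: "decode (encode p) = p"
  by (rule poly_mapping_eqI) (simp add: lookup_map_key lookup_push_forward_inj)

lemma keys_encode: "Poly_Mapping.keys (encode (p :: 'g::{group_add, countable} \<Rightarrow>\<^sub>0 int)) \<subseteq> range (to_nat :: 'g \<Rightarrow> nat)"
  unfolding push_forward_def by (rule order_trans[OF keys_sum]) auto

lemma encode_decode:
  assumes "Poly_Mapping.keys a \<subseteq> range (to_nat :: 'g::{group_add, countable} \<Rightarrow> nat)"
  shows "encode (decode a :: 'g \<Rightarrow>\<^sub>0 int) = a"
proof (rule poly_mapping_eqI)
  fix n
  show "Poly_Mapping.lookup (encode (decode a :: 'g \<Rightarrow>\<^sub>0 int)) n = Poly_Mapping.lookup a n"
  proof (cases "n \<in> range (to_nat :: 'g \<Rightarrow> nat)")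
    case True
    then show ?thesis by (auto simp: lookup_map_key lookup_push_forward_inj)
  next
    case False
    then show ?thesis using assms keys_encode[of "decode a :: 'g \<Rightarrow>\<^sub>0 int"] by (metis in_keys_iff subsetD)
  qed
qed

lemma carrier_group_ring: "carrier (group_ring TYPE('g::{group_add, countable})) = range (encode :: ('g \<Rightarrow>\<^sub>0 int) \<Rightarrow> _)"
proof -
  have "a \<in> range (encode :: ('g \<Rightarrow>\<^sub>0 int) \<Rightarrow> _)" if "Poly_Mapping.keys a \<subseteq> range (to_nat :: 'g \<Rightarrow> nat)" for a
    using encode_decode[OF that] by (metis rangeI)
  then show ?thesis
    using keys_encode[where 'g = 'g] by (auto simp: integral_group_ring_def nat_copy_def)
qed

lemma frag_cmul_single: "frag_cmul c (Poly_Mapping.single n d) = Poly_Mapping.single n (c * d)"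
  by (rule poly_mapping_eqI) (simp add: lookup_single when_def)

lemma frag_extend_push_forward:
  "frag_extend f (push_forward h p) = (\<Sum>x\<in>Poly_Mapping.keys p. frag_cmul (Poly_Mapping.lookup p x) (f (h x)))"
proof -
  have "frag_extend f (Poly_Mapping.single n c) = frag_cmul c (f n)" for n c
    using frag_extend_cmul[of f c "frag_of n"] by (simp only: frag_cmul_single mult_1_right frag_extend_of)
  then show ?thesis by (simp add: push_forward_def frag_extend_sum)
qed

text \<open>The bilinear product of the integral group ring and the convolution of polynomial
  mappings have the same expansion over the supports, so the ring laws carry over.\<close>

lemma group_ring_simps:
  "encode p \<otimes>\<^bsub>group_ring TYPE('g)\<^esub> encode q = encode (p * q)"
  "encode p \<oplus>\<^bsub>group_ring TYPE('g)\<^esub> encode q = encode (p + q)"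
  "\<one>\<^bsub>group_ring TYPE('g)\<^esub> = encode (1 :: 'g \<Rightarrow>\<^sub>0 int)"
  "\<zero>\<^bsub>group_ring TYPE('g)\<^esub> = encode (0 :: 'g \<Rightarrow>\<^sub>0 int)"
  for p q :: "'g::{group_add, countable} \<Rightarrow>\<^sub>0 int"
proof -
  show "encode p \<otimes>\<^bsub>group_ring TYPE('g)\<^esub> encode q = encode (p * q)"
    unfolding mult_eq_sum_single
    by (simp add: integral_group_ring_def nat_copy_def frag_extend_push_forward frag_cmul_sum frag_cmul_single push_forward_sum)
qed (simp_all add: integral_group_ring_def nat_copy_def push_forward_add push_forward_single[of to_nat "0 :: 'g" "1 :: int", simplified])

lemma ring_group_ring: "ring (group_ring TYPE('g::{group_add, countable}))"
proof (rule ringI)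
  show "abelian_group (group_ring TYPE('g))"
  proof (rule abelian_groupI)
    fix x assume "x \<in> carrier (group_ring TYPE('g))"
    then obtain p :: "'g \<Rightarrow>\<^sub>0 int" where "x = encode p" by (auto simp: carrier_group_ring)
    then show "\<exists>y\<in>carrier (group_ring TYPE('g)). y \<oplus>\<^bsub>group_ring TYPE('g)\<^esub> x = \<zero>\<^bsub>group_ring TYPE('g)\<^esub>"
      by (intro bexI[of _ "encode (- p)"]) (simp_all add: carrier_group_ring group_ring_simps del: push_forward_0)
  qed (auto simp: carrier_group_ring group_ring_simps add.assoc add.commute add.left_commute simp del: push_forward_0)
  show "Group.monoid (group_ring TYPE('g))"
    by (rule monoidI) (auto simp: carrier_group_ring group_ring_simps mult.assoc)
qed (auto simp: carrier_group_ring group_ring_simps algebra_simps)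

text \<open>The augmentation, realised by sending every group element to the exponent 0, maps
  \<open>eta\<close> to 2, and twice an integer is never 1.\<close>

lemma emb_eta_not_invertible: "emb i p * emb i eta \<noteq> 1"
proof
  assume *: "emb i p * emb i eta = 1"
  let ?aug = "push_forward (\<lambda>_. 0 :: int) :: (klein free_product \<Rightarrow>\<^sub>0 int) \<Rightarrow> _"
  have "?aug (emb i eta) = 1 + 1"
    by (simp add: eta_def push_forward_add push_forward_1)
  moreover have "?aug (emb i p) * ?aug (emb i eta) = 1"
    using arg_cong[OF *, of ?aug] by (simp add: push_forward_mult push_forward_1)
  ultimately have "?aug (emb i p) + ?aug (emb i p) = 1"
    by (simp only: distrib_left mult_1_right)
  then have "2 * Poly_Mapping.lookup (?aug (emb i p)) 0 = 1"
    by (metis lookup_add lookup_one_zero mult_2)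
  then show False by presburger
qed

section \<open>The free product of Klein bottle groups and its modules of every rank\<close>

theorem theoremC:
  shows "\<exists>G :: nat monoid. group G \<and>
    (\<forall>k :: int. k \<ge> 1 \<longrightarrow>
      (\<exists>S :: (nat \<Rightarrow>\<^sub>0 int, nat \<Rightarrow> (nat \<Rightarrow>\<^sub>0 int)) module.
         stably_free_of_rank (integral_group_ring G) S k \<and>
         \<not> free_module (integral_group_ring G) S))"
proof (intro exI[of _ "nat_copy TYPE(klein free_product)"] conjI allI impI group_nat_copy)
  let ?R = "group_ring TYPE(klein free_product)"
  fix k' :: int assume "k' \<ge> 1"
  then obtain k where k: "k' = int k" "k > 0" by (metis nonneg_int_cases of_nat_0_less_iff zero_less_one order_less_le_trans less_imp_le)
  define a b where "a = alpha - mon 0 1 * beta" and "b = beta * rho'"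
  have ab: "rho * a + eta * b = 1" unfolding a_def b_def by (rule unimodular_rho_eta)
  \<comment> \<open>One copy of the column \<open>(a, b)\<close> and of the row
    \<open>(rho, eta)\<close> for each factor: \<open>n div 2\<close> picks the factor, the parity
    of \<open>n\<close> the entry.\<close>
  define \<alpha> where "\<alpha> n = encode (emb (n div 2) (if even n then a else b))" for n
  define \<epsilon> where "\<epsilon> n = encode (emb (n div 2) (if even n then rho else eta))" for n
  have emb_ab: "emb i rho * emb i a + emb i eta * emb i b = 1" for i
    using arg_cong[OF ab, of "emb i"] by (simp add: push_forward_add push_forward_mult letter_add push_forward_1)
  interpret unimodular_rows ?R "decode :: _ \<Rightarrow> klein free_product \<Rightarrow>\<^sub>0 int" \<alpha> \<epsilon> k
  proof (intro unimodular_rows.intro unimodular_rows_axioms.intro ring_group_ring)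
    show "inj_on (decode :: _ \<Rightarrow> klein free_product \<Rightarrow>\<^sub>0 int) (carrier ?R)"
      by (rule inj_on_inverseI[of _ encode]) (auto simp: carrier_group_ring)
  qed (auto simp: carrier_group_ring group_ring_simps \<alpha>_def \<epsilon>_def emb_ab)
  have "\<not> free_module ?R K"
  proof
    assume "free_module ?R K"
    \<comment> \<open>At index 1 the entries are the images of \<open>b\<close> and
      \<open>eta\<close> in the factor 0, and the augmentation excludes the product 1.\<close>
    moreover have "decode (\<alpha> 1) * decode (\<epsilon> 1) \<noteq> (1 :: klein free_product \<Rightarrow>\<^sub>0 int)"
      by (simp add: \<alpha>_def \<epsilon>_def emb_eta_not_invertible)
    ultimately obtain v w A B :: "nat \<Rightarrow> klein free_product \<Rightarrow>\<^sub>0 int"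
      where *: "\<forall>i<k. decode (\<epsilon> (2 * i)) * v i + decode (\<epsilon> (2 * i + 1)) * w i = 0"
        and one: "1 = (\<Sum>i<k. A i * v i + B i * w i)"
      using free_imp[OF k(2)] by blast
    have "(1 :: int) = 0"
      by (rule no_scalar_in_span[OF no_scalar_values_rho_eta rank_one_kernel_rho_eta, of "{..<k}" v w 1 A B])
         (use * one in \<open>auto simp: \<epsilon>_def\<close>)
    then show False by simp
  qed
  then show "\<exists>S :: (nat \<Rightarrow>\<^sub>0 int, nat \<Rightarrow> (nat \<Rightarrow>\<^sub>0 int)) module.
      stably_free_of_rank ?R S k' \<and> \<not> free_module ?R S"
    using stably_free_K k(1) by blast
qed

end
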